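(* Let $\Omega\subset\mathbb{R}^n$ be a bounded domain. Let $f:\mathbb{R}^{n+1}\to\mathbb{R}$ be a $C^1$ function whose gradient is non-constant and Lipschitzian, and let $L$ be the Lipschitz constant of $\nabla f$. Let $g:\mathbb{R}^{n+1}\to\mathbb{R}$ be a non-negative $C^1$ function with $g(0)=0$ whose gradient is Lipschitzian with Lipschitz constant $\nu<2$. For $u\in H^1(\Omega)$ put $$J(u)=\int_\Omega f(u(x),\nabla u(x))\,dx,\qquad I(u)=\int_\Omega g(u(x),\nabla u(x))\,dx .$$ Let $V$ be a closed linear subspace of $H^1(\Omega)$ for which there exists $v_0\in V$ such that $$\int_\Omega\bigl(f_\xi(0)v_0(x)+\nabla_\eta f(0)\cdot\nabla v_0(x)\bigr)\,dx\neq 0 .$$ Let $S$ and $S_1$ be the (possibly empty) sets of all global minima of the restrictions to $V$ of the functionals $$u\mapsto \|u\|^2+I(u)+\frac{2-\nu}{L}J(u)\qquad\text{and}\qquad u\mapsto \|u\|^2+I(u)-\frac{2-\nu}{L}J(u),$$ respectively. Then $$\delta_1:=\min\left\{\inf_{u\in S}\bigl(\|u\|^2+I(u)\bigr),\ \inf_{u\in S_1}\bigl(\|u\|^2+I(u)\bigr)\right\}>0$$ (with the convention $\inf\emptyset=+\infty$), and, for each $r\in\,]0,\delta_1[$, the restriction of the functional $J$ to the set $$\{u\in V:\ \|u\|^2+I(u)=r\}$$ has a unique global minimum and a unique global maximum (that is, there is exactly one point of this set at which $J$ attains its infimum over the set, and exactly one point at which $J$ attains its supremum over the set).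
   Context: Functions are real-valued. The Sobolev space $H^1(\Omega)$ is endowed with the norm $\|u\|=\left(\int_\Omega(|\nabla u(x)|^2+|u(x)|^2)\,dx\right)^{1/2}$, induced by the scalar product $\langle u,v\rangle=\int_\Omega(\nabla u(x)\cdot\nabla v(x)+u(x)v(x))\,dx$. Points of $\mathbb{R}^{n+1}=\mathbb{R}\times\mathbb{R}^n$ are written $(\xi,\eta)$ with $\xi\in\mathbb{R}$, $\eta\in\mathbb{R}^n$; $f_\xi$ denotes the partial derivative of $f$ with respect to $\xi$ and $\nabla_\eta f$ the gradient of $f$ with respect to $\eta$. "Lipschitzian" is with respect to the Euclidean metric. Because $\nabla f$ and $\nabla g$ have linear growth, $J$ and $I$ are well defined and $C^1$ on $H^1(\Omega)$. Since $\nabla f$ is non-constant, $L>0$. A global minimum (maximum) of a functional on a set means a point of that set at which the functional attains its infimum (supremum) over the set. *)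

theory Defs
  imports "HOL-Analysis.Analysis"
begin

definition grad :: "('a::euclidean_space \<Rightarrow> real) \<Rightarrow> 'a \<Rightarrow> 'a" where
  "grad f z = (THE D. GDERIV f z :> D)"

text \<open>Functions of class \<open>C\<^sup>k\<close> on the whole space: all iterated partial derivatives of
  order at most \<open>k\<close> exist and are continuous.\<close>

primrec C_k :: "nat \<Rightarrow> ('a::euclidean_space \<Rightarrow> real) \<Rightarrow> bool" where
  "C_k 0 f \<longleftrightarrow> continuous_on UNIV f"
| "C_k (Suc k) f \<longleftrightarrow>
     (\<forall>z. f differentiable (at z)) \<and> (\<forall>b\<in>Basis. C_k k (\<lambda>z. grad f z \<bullet> b))"

definition lipschitz_const :: "('a::metric_space \<Rightarrow> 'b::metric_space) \<Rightarrow> real" where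
  "lipschitz_const h = Inf {C. C-lipschitz_on UNIV h}"

definition partial_xi :: "(real \<times> 'a::euclidean_space \<Rightarrow> real) \<Rightarrow> real \<times> 'a \<Rightarrow> real" where
  "partial_xi f z = deriv (\<lambda>s. f (s, snd z)) (fst z)"

definition grad_eta :: "(real \<times> 'a::euclidean_space \<Rightarrow> real) \<Rightarrow> real \<times> 'a \<Rightarrow> 'a" where
  "grad_eta f z = grad (\<lambda>y. f (fst z, y)) (snd z)"


definition test_fun :: "(real^'n) set \<Rightarrow> (real^'n \<Rightarrow> real) \<Rightarrow> bool" where
  "test_fun \<Omega> \<phi> \<longleftrightarrow>
     (\<forall>k. C_k k \<phi>) \<and> compact (closure {x. \<phi> x \<noteq> 0}) \<and> closure {x. \<phi> x \<noteq> 0} \<subseteq> \<Omega>"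

definition square_int :: "(real^'n) set \<Rightarrow> (real^'n \<Rightarrow> 'b::euclidean_space) \<Rightarrow> bool" where
  "square_int \<Omega> h \<longleftrightarrow>
     h \<in> borel_measurable (lebesgue_on \<Omega>) \<and> integrable (lebesgue_on \<Omega>) (\<lambda>x. (norm (h x))\<^sup>2)"

definition has_weak_grad ::
    "(real^'n) set \<Rightarrow> (real^'n \<Rightarrow> real) \<Rightarrow> (real^'n \<Rightarrow> real^'n) \<Rightarrow> bool" where
  "has_weak_grad \<Omega> u G \<longleftrightarrow> square_int \<Omega> G \<and>
     (\<forall>\<phi>. test_fun \<Omega> \<phi> \<longrightarrow>
        (\<forall>i. (\<integral>x. u x * (grad \<phi> x $ i) \<partial>lebesgue_on \<Omega>)
           = - (\<integral>x. (G x $ i) * \<phi> x \<partial>lebesgue_on \<Omega>)))"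

text \<open>Elements of \<open>H\<^sup>1(\<Omega>)\<close> are represented by functions on the whole space, two functions being
  representatives of the same element iff they agree almost everywhere on \<open>\<Omega>\<close>; values outside
  \<open>\<Omega>\<close> are irrelevant. The weak gradient is determined almost everywhere on \<open>\<Omega>\<close>, so
  integrals involving it do not depend on the choice below.\<close>

definition H1 :: "(real^'n) set \<Rightarrow> (real^'n \<Rightarrow> real) set" where
  "H1 \<Omega> = {u. square_int \<Omega> u \<and> (\<exists>G. has_weak_grad \<Omega> u G)}"

definition weak_grad :: "(real^'n) set \<Rightarrow> (real^'n \<Rightarrow> real) \<Rightarrow> real^'n \<Rightarrow> real^'n" where
  "weak_grad \<Omega> u = (SOME G. has_weak_grad \<Omega> u G)"

definition H1_norm :: "(real^'n) set \<Rightarrow> (real^'n \<Rightarrow> real) \<Rightarrow> real" where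
  "H1_norm \<Omega> u = sqrt (\<integral>x. (norm (weak_grad \<Omega> u x))\<^sup>2 + \<bar>u x\<bar>\<^sup>2 \<partial>lebesgue_on \<Omega>)"

text \<open>The closedness clause (applied to constant sequences) also makes \<open>V\<close> contain, with a
  function, every function equal to it almost everywhere on \<open>\<Omega>\<close>; hence such \<open>V\<close> are exactly the
  preimages of the closed linear subspaces of the space of equivalence classes.\<close>

definition closed_subspace_H1 :: "(real^'n) set \<Rightarrow> (real^'n \<Rightarrow> real) set \<Rightarrow> bool" where
  "closed_subspace_H1 \<Omega> V \<longleftrightarrow>
     V \<subseteq> H1 \<Omega> \<and> (\<lambda>x. 0) \<in> V \<and>
     (\<forall>u\<in>V. \<forall>v\<in>V. (\<lambda>x. u x + v x) \<in> V) \<and>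
     (\<forall>c. \<forall>u\<in>V. (\<lambda>x. c * u x) \<in> V) \<and>
     (\<forall>s. \<forall>u\<in>H1 \<Omega>. (\<forall>k. s k \<in> V) \<and>
        (\<lambda>k. H1_norm \<Omega> (\<lambda>x. s k x - u x)) \<longlonglongrightarrow> 0 \<longrightarrow> u \<in> V)"

definition int_functional ::
    "(real^'n) set \<Rightarrow> (real \<times> (real^'n) \<Rightarrow> real) \<Rightarrow> (real^'n \<Rightarrow> real) \<Rightarrow> real" where
  "int_functional \<Omega> f u = (\<integral>x. f (u x, weak_grad \<Omega> u x) \<partial>lebesgue_on \<Omega>)"

text \<open>Existence of exactly one element, where functions that agree almost everywhere on \<open>\<Omega>\<close>
  are identified.\<close>

definition ex1_ae :: "(real^'n) set \<Rightarrow> ((real^'n \<Rightarrow> real) \<Rightarrow> bool) \<Rightarrow> bool" where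
  "ex1_ae \<Omega> P \<longleftrightarrow>
     (\<exists>u. P u \<and> (\<forall>v. P v \<longrightarrow> (AE x in lebesgue_on \<Omega>. v x = u x)))"

end

theory Submission
  imports Defs "HOL-Computational_Algebra.Polynomial"
begin

text \<open>
  Write \<open>N u = \<parallel>u\<parallel>\<^sup>2 + I u\<close> and \<open>a = (2 - \<nu>) / L\<close>. A function whose gradient is Lipschitzian with
  constant \<open>C\<close> fails to be convex by at most \<open>C/4 \<bar>z - w\<bar>\<^sup>2\<close> in the midpoint inequality
  (\<open>lipschitz_grad_midpoint\<close>), while \<open>\<bar>z\<bar>\<^sup>2\<close> gains exactly \<open>1/2 \<bar>z - w\<bar>\<^sup>2\<close>. Integrating these pointwise
  inequalities shows that \<open>N\<close> is strongly convex, and \<open>N + a J\<close> is still convex: \<open>a\<close> is the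
  largest multiplier for which the gain of \<open>N\<close> pays for the defect of \<open>a J\<close>. For \<open>0 \<le> \<lambda> < a\<close> the
  functional \<open>N + \<lambda> J\<close> is a convex combination of the two, hence strongly convex, continuous and
  bounded below on a complete space, and it has a unique minimiser \<open>u\<^sub>\<lambda>\<close>.

  A Lagrange multiplier argument now turns the constrained problem into the search for a \<open>\<lambda>\<close> with
  \<open>N (u\<^sub>\<lambda>) = r\<close>: for such a \<open>\<lambda> > 0\<close>, comparing \<open>N + \<lambda> J\<close> at \<open>u\<^sub>\<lambda>\<close> and at any \<open>v\<close> with \<open>N v = r\<close> shows that
  \<open>u\<^sub>\<lambda>\<close> is the only minimum of \<open>J\<close> on the level set (\<open>level_set_minimiser\<close>). At \<open>\<lambda> = 0\<close> the minimiser
  is \<open>0\<close>, where \<open>N\<close> vanishes. Up to a factor, \<open>N + \<lambda> J\<close> is \<open>(N + a J) + \<epsilon> N\<close> with \<open>\<epsilon> = a/\<lambda> - 1\<close>, so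
  \<open>u\<^sub>\<lambda>\<close> is a Tikhonov regularisation of the convex functional \<open>N + a J\<close> with strongly convex penalty
  \<open>N\<close>. This gives the estimate \<open>c d(u\<^sub>\<lambda>, u\<^sub>\<mu>)\<^sup>2 \<le> N (u\<^sub>\<mu>) - N (u\<^sub>\<lambda>)\<close> for \<open>\<lambda> < \<mu> < a\<close>
  (\<open>minimiser_path_increment\<close>): \<open>N (u\<^sub>\<lambda>)\<close> is nondecreasing in \<open>\<lambda>\<close>, and where it stays
  bounded the minimisers converge in norm along monotone sequences of parameters. Taking limits
  from both sides at \<open>\<lambda>' = sup {\<lambda>. N (u\<^sub>\<lambda>) \<le> r}\<close> gives a minimiser for \<open>\<lambda>'\<close> with \<open>N = r\<close>, unless
  \<open>\<lambda>' = a\<close>; but then the limit from the left would be a minimiser of \<open>N + a J\<close> with \<open>N \<le> r < \<delta>1\<close>, against the definition of \<open>\<delta>1\<close>. Maxima are minima for \<open>- f\<close>.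

  For \<open>\<delta>1 > 0\<close>: otherwise there are minimisers of \<open>N + a J\<close> (or of \<open>N - a J\<close>) with \<open>N\<close> tending to \<open>0\<close>.
  They converge to \<open>0\<close>, so \<open>0\<close> is itself a minimiser. Since \<open>0\<close> also minimises \<open>N\<close>, the derivative of
  \<open>J\<close> at \<open>0\<close> vanishes on \<open>V\<close>, which the hypothesis on \<open>v\<^sub>0\<close> excludes.

  The analytic input is that the Sobolev space, seen through the jets \<open>x \<mapsto> (u x, \<nabla>u x)\<close>, is
  complete and linear up to null sets (\<open>H1_complete\<close>, \<open>H1_combination\<close>). Completeness is that of the
  square integrable functions (\<open>L2_complete\<close>). Linearity rests on the uniqueness of weak gradients, that
  is, on the fundamental lemma of the calculus of variations.
\<close>

section \<open>Functions with Lipschitzian gradient\<close>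

lemma GDERIV_iff: "GDERIV f z :> D \<longleftrightarrow> (f has_derivative (\<lambda>h. h \<bullet> D)) (at z)"
  by (simp add: gderiv_def inner_commute)

lemma grad_eqI: "GDERIV f z :> D \<Longrightarrow> grad f z = D"
proof -
  assume D: "GDERIV f z :> D"
  have "D' = D" if "GDERIV f z :> D'" for D'
  proof -
    have "(\<lambda>h. h \<bullet> D) = (\<lambda>h. h \<bullet> D')"
      using D that unfolding GDERIV_iff by (rule has_derivative_unique)
    thus ?thesis by (metis inner_commute vector_eq_rdot)
  qed
  with D show ?thesis unfolding grad_def by blast
qed

text \<open>
  The definite description in \<open>grad\<close> is only meaningful where a gradient exists; in finite dimension
  it is assembled from the values of the derivative on the basis.
\<close>

lemma differentiable_GDERIV_grad:
  assumes "f differentiable (at z)"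
  shows "GDERIV f z :> grad f z"
proof -
  from assms obtain f' where f': "(f has_derivative f') (at z)"
    by (auto simp: differentiable_def)
  interpret bounded_linear f' using f' by (rule has_derivative_bounded_linear)
  have "f' h = h \<bullet> (\<Sum>b\<in>Basis. f' b *\<^sub>R b)" for h
  proof -
    have "f' h = f' (\<Sum>b\<in>Basis. (h \<bullet> b) *\<^sub>R b)" by (simp add: euclidean_representation)
    also have "\<dots> = (\<Sum>b\<in>Basis. (h \<bullet> b) * f' b)" by (simp add: sum scaleR)
    finally show ?thesis by (simp add: inner_sum_right mult.commute)
  qed
  hence "f' = (\<lambda>h. h \<bullet> (\<Sum>b\<in>Basis. f' b *\<^sub>R b))" by (rule ext)
  with f' have D: "GDERIV f z :> (\<Sum>b\<in>Basis. f' b *\<^sub>R b)"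
    unfolding GDERIV_iff by simp
  show ?thesis using D grad_eqI[OF D] by simp
qed

text \<open>
  Along the segment the derivative of the remainder at parameter \<open>t\<close> is at most \<open>C t \<bar>w - z\<bar>\<^sup>2\<close> in modulus,
  so the remainder is dominated by its integral. The sharp constant \<open>C/2\<close> matters: the theorem holds
  up to the exact multiplier \<open>(2 - \<nu>) / L\<close>.
\<close>

lemma lipschitz_grad_taylor:
  assumes df: "\<And>z. f differentiable (at z)" and lip: "C-lipschitz_on UNIV (grad f)"
  shows "\<bar>f w - f z - grad f z \<bullet> (w - z)\<bar> \<le> C / 2 * (norm (w - z))\<^sup>2"
proof -
  have *: "s * (f w - f z - grad f z \<bullet> (w - z)) \<le> C / 2 * (norm (w - z))\<^sup>2"
    if s: "\<bar>s\<bar> = 1" for s :: real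
  proof -
    define k where "k = w - z"
    define \<phi> where "\<phi> t = C / 2 * t\<^sup>2 * (norm k)\<^sup>2 - s * (f (z + t *\<^sub>R k) - t * (grad f z \<bullet> k))" for t
    have D: "(\<phi> has_real_derivative
        (C * t * (norm k)\<^sup>2 - s * ((grad f (z + t *\<^sub>R k) - grad f z) \<bullet> k))) (at t)" for t
    proof -
      have "((\<lambda>t. f (z + t *\<^sub>R k)) has_derivative (\<lambda>h. (h *\<^sub>R k) \<bullet> grad f (z + t *\<^sub>R k))) (at t)"
        by (rule has_derivative_compose[of "\<lambda>t. z + t *\<^sub>R k"])
          (use differentiable_GDERIV_grad[OF df] GDERIV_iff in \<open>auto intro!: derivative_eq_intros\<close>)
      hence F: "((\<lambda>t. f (z + t *\<^sub>R k)) has_real_derivative (grad f (z + t *\<^sub>R k) \<bullet> k)) (at t)"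
        by (simp add: has_field_derivative_def inner_commute mult_commute_abs)
      show ?thesis unfolding \<phi>_def
        by (rule derivative_eq_intros F refl | simp)+ (simp add: algebra_simps)
    qed
    have "\<phi> 0 \<le> \<phi> 1"
    proof (rule DERIV_nonneg_imp_nondecreasing[where f = \<phi>])
      fix t :: real assume t: "0 \<le> t" "t \<le> 1"
      have "s * ((grad f (z + t *\<^sub>R k) - grad f z) \<bullet> k) \<le> \<bar>s\<bar> * \<bar>(grad f (z + t *\<^sub>R k) - grad f z) \<bullet> k\<bar>"
        by (metis abs_ge_self abs_mult)
      also have "\<dots> \<le> norm (grad f (z + t *\<^sub>R k) - grad f z) * norm k"
        using s Cauchy_Schwarz_ineq2 by simp
      also have "\<dots> \<le> (C * norm (t *\<^sub>R k)) * norm k"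
        using lipschitz_onD[OF lip, of "z + t *\<^sub>R k" z] by (intro mult_right_mono) (auto simp: dist_norm)
      also have "\<dots> = C * t * (norm k)\<^sup>2" using t by (simp add: power2_eq_square)
      finally have "0 \<le> C * t * (norm k)\<^sup>2 - s * ((grad f (z + t *\<^sub>R k) - grad f z) \<bullet> k)"
        by simp
      with D[of t] show "\<exists>y. (\<phi> has_real_derivative y) (at t) \<and> 0 \<le> y"
        by blast
    qed simp
    moreover have "\<phi> 0 = - (s * f z)" by (simp add: \<phi>_def)
    moreover have "\<phi> 1 = C / 2 * (norm k)\<^sup>2 - s * (f w - grad f z \<bullet> k)"
      by (simp add: \<phi>_def k_def)
    ultimately show ?thesis unfolding k_def[symmetric] by (simp only: right_diff_distrib)
  qed
  show ?thesis using *[of 1] *[of "-1"] by (simp add: abs_if)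
qed

lemma lipschitz_grad_upper:
  assumes df: "\<And>z. f differentiable (at z)" and lip: "C-lipschitz_on UNIV (grad f)"
  shows "f w \<le> f z + grad f z \<bullet> (w - z) + C / 2 * (norm (w - z))\<^sup>2"
  using abs_le_D1[OF lipschitz_grad_taylor[OF df lip, of w z]] by linarith

lemma lipschitz_grad_lower:
  assumes df: "\<And>z. f differentiable (at z)" and lip: "C-lipschitz_on UNIV (grad f)"
  shows "f z + grad f z \<bullet> (w - z) - C / 2 * (norm (w - z))\<^sup>2 \<le> f w"
  using abs_le_D2[OF lipschitz_grad_taylor[OF df lip, of w z]] by linarith

text \<open>
  Expanding at the midpoint, the two first order terms cancel.
\<close>

lemma lipschitz_grad_midpoint:
  assumes df: "\<And>z. f differentiable (at z)" and lip: "C-lipschitz_on UNIV (grad f)"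
  shows "2 * f ((1 / 2) *\<^sub>R (z + w)) \<le> f z + f w + C / 4 * (norm (z - w))\<^sup>2"
proof -
  define m where "m = (1 / 2) *\<^sub>R (z + w)"
  define k where "k = (1 / 2) *\<^sub>R (z - w)"
  have z: "z - m = k" and w: "w - m = - k"
    by (simp_all add: m_def k_def algebra_simps flip: scaleR_add_left)
  define q where "q = C / 2 * (norm k)\<^sup>2"
  have q: "C / 4 * (norm (z - w))\<^sup>2 = 2 * q" by (simp add: q_def k_def power_divide)
  have "f m + grad f m \<bullet> k - q \<le> f z"
    using lipschitz_grad_lower[OF df lip, of m z] by (simp only: z q_def)
  moreover have "f m - grad f m \<bullet> k - q \<le> f w"
    using lipschitz_grad_lower[OF df lip, of m w] by (simp add: w q_def)
  ultimately show ?thesis unfolding m_def[symmetric] q by linarith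
qed

lemma grad_uminus:
  assumes "f differentiable (at z)"
  shows "grad (\<lambda>z. - f z) z = - grad f z"
  by (rule grad_eqI, rule GDERIV_minus, rule differentiable_GDERIV_grad[OF assms])

lemma grad_pair_component:
  fixes f :: "real \<times> 'a::euclidean_space \<Rightarrow> real"
  assumes "f differentiable (at z)"
  shows "partial_xi f z = fst (grad f z)" "grad_eta f z = snd (grad f z)"
proof -
  have G: "(f has_derivative (\<lambda>h. h \<bullet> grad f z)) (at (fst z, snd z))"
    using differentiable_GDERIV_grad[OF assms] GDERIV_iff by auto
  have "((\<lambda>s. f (s, snd z)) has_derivative (\<lambda>h. (h, 0) \<bullet> grad f z)) (at (fst z))"
    by (rule has_derivative_compose[where f = "\<lambda>s. (s, snd z)" and f' = "\<lambda>h. (h, 0)", OF _ G])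
      (intro has_derivative_Pair has_derivative_ident has_derivative_const)
  hence "((\<lambda>s. f (s, snd z)) has_real_derivative (fst (grad f z))) (at (fst z))"
    unfolding has_field_derivative_def inner_prod_def by (simp add: mult.commute[of _ "fst (grad f z)"])
  thus "partial_xi f z = fst (grad f z)" unfolding partial_xi_def by (rule DERIV_imp_deriv)
  have "((\<lambda>y. f (fst z, y)) has_derivative (\<lambda>h. (0, h) \<bullet> grad f z)) (at (snd z))"
    by (rule has_derivative_compose[where f = "\<lambda>y. (fst z, y)" and f' = "\<lambda>h. (0, h)", OF _ G])
      (intro has_derivative_Pair has_derivative_ident has_derivative_const)
  hence "GDERIV (\<lambda>y. f (fst z, y)) (snd z) :> snd (grad f z)"
    by (simp add: GDERIV_iff inner_prod_def)
  thus "grad_eta f z = snd (grad f z)" unfolding grad_eta_def by (rule grad_eqI)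
qed

text \<open>
  The infimum over all Lipschitz constants is itself one, because each instance of the Lipschitz
  inequality is a closed condition on the constant.
\<close>

lemma lipschitz_const_attained:
  assumes "\<exists>C. C-lipschitz_on UNIV h"
  shows "(lipschitz_const h)-lipschitz_on UNIV h"
proof (rule lipschitz_onI)
  let ?S = "{C. C-lipschitz_on UNIV h}"
  have bdd: "bdd_below ?S" by (rule bdd_belowI[of _ 0]) (auto dest: lipschitz_on_nonneg)
  have ne: "?S \<noteq> {}" using assms by auto
  show "0 \<le> lipschitz_const h"
    unfolding lipschitz_const_def using ne by (intro cInf_greatest) (auto dest: lipschitz_on_nonneg)
  fix x y
  show "dist (h x) (h y) \<le> lipschitz_const h * dist x y"
  proof (cases "x = y")
    case False
    have "dist (h x) (h y) / dist x y \<le> Inf ?S"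
      using ne False by (intro cInf_greatest) (auto simp: divide_le_eq dest: lipschitz_onD)
    with False show ?thesis by (simp add: lipschitz_const_def divide_le_eq)
  qed simp
qed

lemma lipschitz_const_pos:
  assumes "\<exists>C. C-lipschitz_on UNIV h" "\<not> h constant_on UNIV"
  shows "0 < lipschitz_const h"
proof -
  note lip = lipschitz_const_attained[OF assms(1)]
  have "lipschitz_const h \<noteq> 0"
  proof
    assume "lipschitz_const h = 0"
    hence "h x = h y" for x y using lipschitz_onD[OF lip, of x y] by simp
    with assms(2) show False by (auto simp: constant_on_def)
  qed
  with lipschitz_on_nonneg[OF lip] show ?thesis by simp
qed

section \<open>Minimisers along a parameter in complete midpoint spaces\<close>

text \<open>
  The variational argument uses convexity only at midpoints and completeness only for a
  pseudo-distance, so it is stated without linear structure. Elements at distance \<open>0\<close> are not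
  identified, which lets functions stand for their classes modulo null sets.
\<close>

locale complete_midpoint_space =
  fixes V :: "'a set" and mid :: "'a \<Rightarrow> 'a \<Rightarrow> 'a" and d :: "'a \<Rightarrow> 'a \<Rightarrow> real"
  assumes V_nonempty: "V \<noteq> {}"
    and mid_closed: "u \<in> V \<Longrightarrow> v \<in> V \<Longrightarrow> mid u v \<in> V"
    and d_nonneg: "0 \<le> d u v"
    and d_self: "d u u = 0"
    and d_sym: "u \<in> V \<Longrightarrow> v \<in> V \<Longrightarrow> d u v = d v u"
    and complete: "(\<And>k. s k \<in> V) \<Longrightarrow>
      (\<And>e. 0 < e \<Longrightarrow> \<exists>M. \<forall>m\<ge>M. \<forall>n\<ge>m. d (s m) (s n) < e) \<Longrightarrow>
      \<exists>u\<in>V. (\<lambda>k. d (s k) u) \<longlonglongrightarrow> 0"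
begin

definition seq_continuous :: "('a \<Rightarrow> real) \<Rightarrow> bool" where
  "seq_continuous \<Phi> \<longleftrightarrow> (\<forall>s. \<forall>u\<in>V. (\<forall>k. s k \<in> V) \<and> (\<lambda>k. d (s k) u) \<longlonglongrightarrow> 0
     \<longrightarrow> (\<lambda>k. \<Phi> (s k)) \<longlonglongrightarrow> \<Phi> u)"

text \<open>
  For \<open>c = 0\<close> this is midpoint convexity, for \<open>c > 0\<close> a form of strong convexity.
\<close>

definition midpoint_convex :: "real \<Rightarrow> ('a \<Rightarrow> real) \<Rightarrow> bool" where
  "midpoint_convex c \<Phi> \<longleftrightarrow>
     (\<forall>u\<in>V. \<forall>v\<in>V. 2 * \<Phi> (mid u v) + c * (d u v)\<^sup>2 \<le> \<Phi> u + \<Phi> v)"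

definition minimises :: "('a \<Rightarrow> real) \<Rightarrow> 'a \<Rightarrow> bool" where
  "minimises \<Phi> u \<longleftrightarrow> u \<in> V \<and> (\<forall>v\<in>V. \<Phi> u \<le> \<Phi> v)"

lemma seq_continuousD:
  "seq_continuous \<Phi> \<Longrightarrow> (\<And>k. s k \<in> V) \<Longrightarrow> u \<in> V \<Longrightarrow> (\<lambda>k. d (s k) u) \<longlonglongrightarrow> 0
     \<Longrightarrow> (\<lambda>k. \<Phi> (s k)) \<longlonglongrightarrow> \<Phi> u"
  unfolding seq_continuous_def by blast

lemma seq_continuous_combination:
  assumes "seq_continuous \<Phi>" "seq_continuous \<Psi>"
  shows "seq_continuous (\<lambda>u. a * \<Phi> u + b * \<Psi> u)"
  using assms unfolding seq_continuous_def
  by (intro ballI allI impI tendsto_add tendsto_mult_left) blast+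

lemma seq_continuous_eq:
  assumes "seq_continuous \<Phi>" "u \<in> V" "v \<in> V" "d u v = 0"
  shows "\<Phi> u = \<Phi> v"
proof -
  have "(\<lambda>k::nat. \<Phi> u) \<longlonglongrightarrow> \<Phi> v"
    using seq_continuousD[OF assms(1), of "\<lambda>k. u" v] assms by simp
  thus ?thesis by (simp add: LIMSEQ_const_iff)
qed

text \<open>
  The midpoint of two minimisers would do strictly better if they were apart.
\<close>

lemma minimiser_unique:
  assumes "midpoint_convex c \<Phi>" "0 < c" "minimises \<Phi> u" "minimises \<Phi> v"
  shows "d u v = 0"
proof -
  have uv: "u \<in> V" "v \<in> V" "\<Phi> u = \<Phi> v"
    using assms(3,4) unfolding minimises_def by (auto intro: antisym)
  have "\<Phi> u \<le> \<Phi> (mid u v)" using assms(3) mid_closed uv unfolding minimises_def by blast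
  moreover have "2 * \<Phi> (mid u v) + c * (d u v)\<^sup>2 \<le> \<Phi> u + \<Phi> v"
    using assms(1) uv unfolding midpoint_convex_def by blast
  ultimately have "c * (d u v)\<^sup>2 \<le> 0" using uv by linarith
  thus ?thesis using assms(2) by (simp add: mult_le_0_iff)
qed

text \<open>
  Both limit arguments below bound squared distances by the deviations of a convergent real
  sequence from its limit.
\<close>

lemma cauchy_criterion:
  assumes s: "\<And>k. s k \<in> V" and c: "0 < c"
    and bound: "\<And>m n. m \<le> n \<Longrightarrow> c * (d (s m) (s n))\<^sup>2 \<le> \<bar>y m - l\<bar> + \<bar>y n - l\<bar>"
    and y: "y \<longlonglongrightarrow> (l::real)"
  shows "\<exists>u\<in>V. (\<lambda>k. d (s k) u) \<longlonglongrightarrow> 0"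
proof (rule complete[OF s])
  fix e :: real assume e: "0 < e"
  define \<epsilon> where "\<epsilon> = c * e\<^sup>2 / 2"
  have "0 < \<epsilon>" using c e by (simp add: \<epsilon>_def)
  with y obtain M where M: "\<And>n. n \<ge> M \<Longrightarrow> \<bar>y n - l\<bar> < \<epsilon>"
    unfolding LIMSEQ_def dist_real_def by blast
  have "d (s m) (s n) < e" if "M \<le> m" "m \<le> n" for m n
  proof -
    have "c * (d (s m) (s n))\<^sup>2 < c * e\<^sup>2"
      using bound[OF that(2)] M[of m] M[of n] that unfolding \<epsilon>_def by simp
    hence "(d (s m) (s n))\<^sup>2 < e\<^sup>2" using c by simp
    thus ?thesis using e power_less_imp_less_base by (metis less_imp_le)
  qed
  thus "\<exists>M. \<forall>m\<ge>M. \<forall>n\<ge>m. d (s m) (s n) < e" by blast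
qed

text \<open>
  Strong convexity makes every minimising sequence a Cauchy sequence: the midpoint of two almost
  minimal elements cannot be much better than either.
\<close>

lemma minimiser_exists:
  assumes conv: "midpoint_convex c \<Phi>" "0 < c" and cont: "seq_continuous \<Phi>"
    and bdd: "\<And>u. u \<in> V \<Longrightarrow> B \<le> \<Phi> u"
  shows "\<exists>u. minimises \<Phi> u"
proof -
  define l where "l = Inf (\<Phi> ` V)"
  have bb: "bdd_below (\<Phi> ` V)" using bdd by (intro bdd_belowI2)
  have l: "l \<le> \<Phi> u" if "u \<in> V" for u
    unfolding l_def using bb that by (intro cInf_lower) auto
  have "\<exists>u\<in>V. \<Phi> u < l + 1 / real (Suc k)" for k
  proof -
    have "Inf (\<Phi> ` V) < l + 1 / real (Suc k)" by (simp add: l_def)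
    thus ?thesis using cInf_less_iff[OF _ bb] V_nonempty by auto
  qed
  then obtain s where s: "\<And>k. s k \<in> V" "\<And>k. \<Phi> (s k) < l + 1 / real (Suc k)" by metis
  define y where "y k = l + 1 / real (Suc k)" for k
  have y: "y \<longlonglongrightarrow> l"
    unfolding y_def using tendsto_add[OF tendsto_const[of l] LIMSEQ_inverse_real_of_nat]
    by (simp add: inverse_eq_divide)
  have yl: "l \<le> y n" for n by (simp add: y_def)
  have "c * (d (s m) (s n))\<^sup>2 \<le> \<bar>y m - l\<bar> + \<bar>y n - l\<bar>" if "m \<le> n" for m n
  proof -
    have "2 * \<Phi> (mid (s m) (s n)) + c * (d (s m) (s n))\<^sup>2 \<le> \<Phi> (s m) + \<Phi> (s n)"
      using conv s unfolding midpoint_convex_def by blast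
    moreover have "l \<le> \<Phi> (mid (s m) (s n))" using l mid_closed s by blast
    moreover have "\<Phi> (s m) \<le> y m" "\<Phi> (s n) \<le> y n"
      using s(2)[of m] s(2)[of n] by (auto simp: y_def)
    ultimately show ?thesis using yl[of m] yl[of n] by (smt (verit))
  qed
  from cauchy_criterion[OF s(1) conv(2) this y]
  obtain u where u: "u \<in> V" "(\<lambda>k. d (s k) u) \<longlonglongrightarrow> 0" by blast
  have "(\<lambda>k. \<Phi> (s k)) \<longlonglongrightarrow> \<Phi> u" by (rule seq_continuousD[OF cont s(1) u])
  hence "\<Phi> u \<le> l" by (rule LIMSEQ_le[OF _ y]) (use s(2) in \<open>auto simp: y_def intro: less_imp_le\<close>)
  hence "\<Phi> u \<le> \<Phi> v" if "v \<in> V" for v using l[OF that] by linarith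
  with u show ?thesis unfolding minimises_def by blast
qed

text \<open>
  \<open>N + l J\<close> is the convex combination of \<open>N + a J\<close> and \<open>N\<close> with weights \<open>l/a\<close> and \<open>1 - l/a\<close>.
\<close>

lemma midpoint_convex_interpolate:
  assumes "midpoint_convex c N" "midpoint_convex 0 (\<lambda>u. N u + a * J u)"
    and "0 \<le> l" "l \<le> a" "0 < a"
  shows "midpoint_convex ((1 - l / a) * c) (\<lambda>u. N u + l * J u)"
  unfolding midpoint_convex_def
proof (intro ballI)
  fix u v assume uv: "u \<in> V" "v \<in> V"
  define P where "P v = N v + a * J v" for v
  define t where "t = l / a"
  have t: "0 \<le> t" "t \<le> 1" using assms by (simp_all add: t_def)
  have split: "N v + l * J v = t * P v + (1 - t) * N v" for v
    using assms by (simp add: t_def P_def field_simps)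
  have "(1 - t) * (2 * N (mid u v) + c * (d u v)\<^sup>2) \<le> (1 - t) * (N u + N v)"
    using assms(1) uv t unfolding midpoint_convex_def by (intro mult_left_mono) auto
  moreover have "t * (2 * P (mid u v)) \<le> t * (P u + P v)"
    using assms(2) uv t unfolding midpoint_convex_def P_def by (intro mult_left_mono) auto
  ultimately show "2 * (N (mid u v) + l * J (mid u v)) + (1 - l / a) * c * (d u v)\<^sup>2
      \<le> N u + l * J u + (N v + l * J v)"
    unfolding split t_def[symmetric] by (simp add: algebra_simps)
qed

context
  fixes N J :: "'a \<Rightarrow> real" and a c :: real and U :: "real \<Rightarrow> 'a"
  assumes a: "0 < a" and c: "0 < c"
    and N_conv: "midpoint_convex c N" and N_cont: "seq_continuous N"
    and P_conv: "midpoint_convex 0 (\<lambda>u. N u + a * J u)" and J_cont: "seq_continuous J"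
    and U: "\<And>l. 0 \<le> l \<Longrightarrow> l < a \<Longrightarrow> minimises (\<lambda>v. N v + l * J v) (U l)"
begin

text \<open>
  The heart of the argument. With \<open>P = N + a J\<close> the functional minimised by \<open>U l\<close> is a positive
  combination of \<open>P\<close> and \<open>N\<close> in which the weight of \<open>P\<close> grows with \<open>l\<close>. Hence \<open>P\<close> does not increase
  and \<open>N\<close> does not decrease along the path. The midpoint \<open>w\<close> of \<open>U l\<close> and \<open>U m\<close> satisfies \<open>P w \<le> P (U l)\<close> by convexity, so
  minimality of \<open>U l\<close> forces \<open>N (U l) \<le> N w\<close>, and the strong convexity of \<open>N\<close> bounds the distance. The
  constant does not degenerate as \<open>l\<close> approaches \<open>a\<close>.
\<close>

lemma minimiser_path_increment:
  assumes l: "0 \<le> l" "l < m" "m < a"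
  shows "c * (d (U l) (U m))\<^sup>2 \<le> N (U m) - N (U l)"
proof -
  have UV: "U l \<in> V" "U m \<in> V" using U[of l] U[of m] l unfolding minimises_def by auto
  define w where "w = mid (U l) (U m)"
  have w: "w \<in> V" using UV mid_closed by (simp add: w_def)
  have i: "N (U l) + l * J (U l) \<le> N v + l * J v"
    and j: "N (U m) + m * J (U m) \<le> N v + m * J v" if "v \<in> V" for v
    using U[of l] U[of m] l that unfolding minimises_def by auto
  have "(m - l) * (J (U m) - J (U l)) \<le> 0"
    using i[OF UV(2)] j[OF UV(1)] by (simp add: algebra_simps)
  hence JJ: "J (U m) \<le> J (U l)" using l by (simp add: mult_le_0_iff)
  have NN: "N (U l) \<le> N (U m)"
    using i[OF UV(2)] mult_left_mono[OF JJ l(1)] by linarith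
  define P where "P v = N v + a * J v" for v
  define s where "s = l / a"
  define t where "t = m / a"
  have split: "N v + l * J v = s * P v + (1 - s) * N v"
    "N v + m * J v = t * P v + (1 - t) * N v" for v
    using a by (simp_all add: s_def t_def P_def field_simps)
  have st: "0 \<le> s" "s < 1" "0 < t" "t < 1" using l a by (simp_all add: s_def t_def)
  have PP: "P (U m) \<le> P (U l)"
  proof -
    have "t * P (U m) + (1 - t) * N (U m) \<le> t * P (U l) + (1 - t) * N (U l)"
      using j[OF UV(1)] by (simp only: split)
    moreover have "(1 - t) * N (U l) \<le> (1 - t) * N (U m)" using NN st by (intro mult_left_mono) auto
    ultimately have "t * P (U m) \<le> t * P (U l)" by linarith
    thus ?thesis using st by simp
  qed
  have "2 * P w + 0 * (d (U l) (U m))\<^sup>2 \<le> P (U l) + P (U m)"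
    using P_conv UV unfolding midpoint_convex_def P_def w_def by blast
  hence "P w \<le> P (U l)" using PP by simp
  hence "s * P w \<le> s * P (U l)" using st by (intro mult_left_mono)
  moreover have "s * P (U l) + (1 - s) * N (U l) \<le> s * P w + (1 - s) * N w"
    using i[OF w] by (simp only: split)
  ultimately have "(1 - s) * N (U l) \<le> (1 - s) * N w" by linarith
  hence "N (U l) \<le> N w" using st by simp
  moreover have "2 * N w + c * (d (U l) (U m))\<^sup>2 \<le> N (U l) + N (U m)"
    using N_conv UV unfolding midpoint_convex_def w_def by blast
  ultimately show ?thesis by linarith
qed

lemma minimiser_path_mono:
  assumes "0 \<le> l" "l \<le> m" "m < a"
  shows "N (U l) \<le> N (U m)"
proof (cases "l = m")
  case False
  have "0 \<le> c * (d (U l) (U m))\<^sup>2" using c by simp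
  with minimiser_path_increment[of l m] assms False show ?thesis by linarith
qed simp

text \<open>
  By the previous estimate a monotone sequence of parameters on which \<open>N\<close> stays bounded yields a Cauchy
  sequence of minimisers. The limit parameter may be \<open>a\<close> itself, where strong convexity is lost:
  the minimiser found there is the limit of the regularised ones.
\<close>

lemma minimiser_path_limit:
  assumes l: "\<And>k. 0 \<le> l k" "\<And>k. l k < a" "l \<longlonglongrightarrow> l'" and mono: "incseq l \<or> decseq l"
    and bdd: "\<And>k. N (U (l k)) \<le> B" "\<And>k. B' \<le> N (U (l k))"
  shows "\<exists>v. minimises (\<lambda>v. N v + l' * J v) v \<and> (\<lambda>k. N (U (l k))) \<longlonglongrightarrow> N v"
proof -
  have UV: "U (l k) \<in> V" for k using U l unfolding minimises_def by blast
  have key: "c * (d (U (l i)) (U (l j)))\<^sup>2 \<le> \<bar>N (U (l i)) - N (U (l j))\<bar>" for i j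
    using minimiser_path_increment[of "l i" "l j"] minimiser_path_increment[of "l j" "l i"] l
      d_sym[OF UV UV, of i j] d_self
    by (cases "l i" "l j" rule: linorder_cases) auto
  have "monoseq (\<lambda>k. N (U (l k)))"
    using mono minimiser_path_mono l unfolding monoseq_iff incseq_def decseq_def by blast
  moreover have "Bseq (\<lambda>k. N (U (l k)))"
    unfolding Bseq_def
  proof (intro exI[of _ "\<bar>B\<bar> + \<bar>B'\<bar> + 1"] conjI allI)
    show "norm (N (U (l k))) \<le> \<bar>B\<bar> + \<bar>B'\<bar> + 1" for k
      using bdd[of k] by auto
  qed simp
  ultimately have "convergent (\<lambda>k. N (U (l k)))" by (simp add: Bseq_monoseq_convergent)
  then obtain y where y: "(\<lambda>k. N (U (l k))) \<longlonglongrightarrow> y" by (auto simp: convergent_def)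
  have "c * (d (U (l i)) (U (l j)))\<^sup>2 \<le> \<bar>N (U (l i)) - y\<bar> + \<bar>N (U (l j)) - y\<bar>" for i j
    using abs_triangle_ineq4[of "N (U (l i)) - y" "N (U (l j)) - y"]
    by (intro order_trans[OF key[of i j]]) simp
  from cauchy_criterion[OF UV c this y]
  obtain v where v: "v \<in> V" "(\<lambda>k. d (U (l k)) v) \<longlonglongrightarrow> 0" by blast
  have Nv: "(\<lambda>k. N (U (l k))) \<longlonglongrightarrow> N v" and Jv: "(\<lambda>k. J (U (l k))) \<longlonglongrightarrow> J v"
    using seq_continuousD[OF N_cont UV v] seq_continuousD[OF J_cont UV v] by auto
  have "N v + l' * J v \<le> N w + l' * J w" if w: "w \<in> V" for w
  proof (rule LIMSEQ_le)
    show "(\<lambda>k. N (U (l k)) + l k * J (U (l k))) \<longlonglongrightarrow> N v + l' * J v"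
      by (intro tendsto_intros Nv Jv l)
    show "(\<lambda>k. N w + l k * J w) \<longlonglongrightarrow> N w + l' * J w"
      by (intro tendsto_intros l)
  qed (use U l w in \<open>auto simp: minimises_def\<close>)
  with v Nv show ?thesis unfolding minimises_def by blast
qed

text \<open>
  Intermediate value argument at \<open>l' = sup {l. N (U l) \<le> r}\<close>. Limits from the left exclude \<open>l' = a\<close> and give
  \<open>N (U l') \<le> r\<close>; limits from the right give \<open>N (U l') \<ge> r\<close>.
\<close>

lemma minimiser_path_attains:
  assumes start: "N (U 0) < r"
    and end_above: "\<And>u. minimises (\<lambda>v. N v + a * J v) u \<Longrightarrow> r < N u"
  shows "\<exists>l. 0 < l \<and> l < a \<and> N (U l) = r"
proof -
  define A where "A = {l. 0 \<le> l \<and> l < a \<and> N (U l) \<le> r}"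
  have A0: "0 \<in> A" using a start by (simp add: A_def)
  have bA: "bdd_above A" by (rule bdd_aboveI[of _ a]) (auto simp: A_def)
  define l' where "l' = Sup A"
  have l'0: "0 \<le> l'" unfolding l'_def using A0 bA by (rule cSup_upper)
  have l'a: "l' \<le> a" unfolding l'_def using A0 by (intro cSup_least) (auto simp: A_def)
  have below: "N (U x) \<le> r" if "0 \<le> x" "x < l'" for x
  proof -
    have "A \<noteq> {}" using A0 by blast
    with \<open>x < l'\<close> obtain y where "y \<in> A" "x < y"
      unfolding l'_def by (auto simp: less_cSup_iff[OF _ bA])
    thus ?thesis using minimiser_path_mono[of x y] that by (auto simp: A_def)
  qed
  have above: "r < N (U x)" if "l' < x" "x < a" for x
  proof (rule ccontr)
    assume "\<not> r < N (U x)"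
    hence "x \<in> A" using that l'0 by (simp add: A_def)
    hence "x \<le> l'" unfolding l'_def using bA by (rule cSup_upper)
    with that show False by simp
  qed
  have U0: "N (U 0) \<le> N (U x)" if "0 \<le> x" "x < a" for x using minimiser_path_mono[of 0 x] that by simp
  have left: "\<exists>v. minimises (\<lambda>v. N v + l' * J v) v \<and> N v \<le> r"
  proof (cases "l' = 0")
    case True
    with U[OF order_refl a] start show ?thesis by (intro exI[of _ "U 0"]) simp
  next
    case False
    (* a sequence in the interval from 0 to l' that increases to l' *)
    define l where "l k = l' * (1 - 1 / real (Suc k))" for k
    have l: "0 \<le> l k" "l k < l'" for k
      using l'0 False by (auto simp: l_def field_simps)
    have lim: "l \<longlonglongrightarrow> l'"
    proof -
      have "(\<lambda>k. l' * (1 - inverse (real (Suc k)))) \<longlonglongrightarrow> l' * (1 - 0)"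
        by (intro tendsto_intros LIMSEQ_inverse_real_of_nat)
      thus ?thesis by (simp add: l_def[abs_def] inverse_eq_divide)
    qed
    have inc: "incseq l"
      unfolding incseq_def l_def using l'0 by (auto intro!: mult_left_mono simp: frac_le)
    have la: "l k < a" for k using l(2)[of k] l'a by simp
    have Nl: "N (U (l k)) \<le> r" for k by (rule below[OF l])
    have "\<exists>v. minimises (\<lambda>v. N v + l' * J v) v \<and> (\<lambda>k. N (U (l k))) \<longlonglongrightarrow> N v"
      by (rule minimiser_path_limit[OF l(1) la lim disjI1[OF inc] Nl U0[OF l(1) la]])
    then obtain v where v: "minimises (\<lambda>v. N v + l' * J v) v" "(\<lambda>k. N (U (l k))) \<longlonglongrightarrow> N v"
      by (elim exE conjE)
    have "N v \<le> r" using Nl by (intro LIMSEQ_le_const2[OF v(2)] exI[of _ 0] allI impI)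
    with v(1) show ?thesis by (intro exI[of _ v] conjI)
  qed
  then obtain v where v: "minimises (\<lambda>v. N v + l' * J v) v" "N v \<le> r" by (elim exE conjE)
  have "l' \<noteq> a" using end_above[of v] v by auto
  hence l'a: "l' < a" using l'a by simp
  (* a sequence that decreases to l'; the index shift keeps its first term below a *)
  define l where "l k = l' + (a - l') / (real (Suc (Suc k)))" for k
  have l: "l' < l k" "l k < a" for k
  proof -
    have "(a - l') / real (Suc (Suc k)) < (a - l') / 1"
      using l'a by (intro divide_strict_left_mono) auto
    thus "l' < l k" "l k < a" using l'a by (auto simp: l_def)
  qed
  have lim: "l \<longlonglongrightarrow> l'"
  proof -
    have "(\<lambda>k. l' + (a - l') * inverse (real (Suc (Suc k)))) \<longlonglongrightarrow> l' + (a - l') * 0"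
      by (intro tendsto_add tendsto_mult tendsto_const LIMSEQ_Suc[OF LIMSEQ_inverse_real_of_nat])
    thus ?thesis by (simp add: l_def[abs_def] divide_inverse)
  qed
  have dec: "decseq l"
    unfolding decseq_def l_def using l'a by (auto intro!: divide_left_mono)
  have bound: "N (U (l k)) \<le> N (U (l 0))" for k
    using l[of k] l[of 0] l'0 dec by (intro minimiser_path_mono) (auto simp: decseq_def)
  have l0: "0 \<le> l k" for k using l'0 l(1)[of k] by linarith
  have "\<exists>w. minimises (\<lambda>v. N v + l' * J v) w \<and> (\<lambda>k. N (U (l k))) \<longlonglongrightarrow> N w"
    by (rule minimiser_path_limit[OF l0 l(2) lim disjI2[OF dec] bound U0[OF l0 l(2)]])
  then obtain w where w: "minimises (\<lambda>v. N v + l' * J v) w" "(\<lambda>k. N (U (l k))) \<longlonglongrightarrow> N w"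
    by (elim exE conjE)
  have "r \<le> N (U (l k))" for k using above[OF l] by (rule less_imp_le)
  hence rw: "r \<le> N w" by (intro LIMSEQ_le_const[OF w(2)] exI[of _ 0] allI impI)
  have strict: "midpoint_convex ((1 - l' / a) * c) (\<lambda>v. N v + l' * J v)"
    using N_conv P_conv l'0 l'a a by (intro midpoint_convex_interpolate) auto
  have pos: "0 < (1 - l' / a) * c" using a c l'a by simp
  have Ul': "minimises (\<lambda>v. N v + l' * J v) (U l')" by (rule U[OF l'0 l'a])
  have eq: "N (U l') = N x" if "minimises (\<lambda>v. N v + l' * J v) x" for x
    using minimiser_unique[OF strict pos Ul' that] Ul' that N_cont
    by (intro seq_continuous_eq) (auto simp: minimises_def)
  have "N (U l') = r" using eq[OF v(1)] eq[OF w(1)] v(2) rw by simp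
  moreover have "l' \<noteq> 0" using calculation start by auto
  ultimately show ?thesis using l'0 l'a by (intro exI[of _ l']) auto
qed

end

text \<open>
  Lagrange multipliers: where \<open>N\<close> is constant, minimising \<open>J\<close> and minimising \<open>N + l J\<close> with \<open>l > 0\<close> is the same.
\<close>

theorem level_set_minimiser:
  assumes a: "0 < a" and c: "0 < c"
    and N_conv: "midpoint_convex c N" and N_cont: "seq_continuous N"
    and P_conv: "midpoint_convex 0 (\<lambda>u. N u + a * J u)" and J_cont: "seq_continuous J"
    and bdd: "\<And>l. 0 \<le> l \<Longrightarrow> l < a \<Longrightarrow> \<exists>B. \<forall>u\<in>V. B \<le> N u + l * J u"
    and z: "z \<in> V" "N z < r"
    and end_above: "\<And>u. minimises (\<lambda>v. N v + a * J v) u \<Longrightarrow> r < N u"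
  shows "\<exists>u\<in>V. N u = r \<and> (\<forall>v\<in>V. N v = r \<longrightarrow> J u \<le> J v \<and> (J v = J u \<longrightarrow> d u v = 0))"
proof -
  have strict: "midpoint_convex ((1 - l / a) * c) (\<lambda>v. N v + l * J v)" "0 < (1 - l / a) * c"
    if "0 \<le> l" "l < a" for l
  proof -
    show "midpoint_convex ((1 - l / a) * c) (\<lambda>v. N v + l * J v)"
      by (rule midpoint_convex_interpolate[OF N_conv P_conv]) (use that a in linarith)+
    show "0 < (1 - l / a) * c" using that a c by simp
  qed
  have ex: "\<exists>u. minimises (\<lambda>v. N v + l * J v) u" if l: "0 \<le> l" "l < a" for l
  proof -
    obtain B where B: "\<forall>u\<in>V. B \<le> N u + l * J u" using bdd l by blast
    have cont: "seq_continuous (\<lambda>v. N v + l * J v)"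
      using seq_continuous_combination[OF N_cont J_cont, of 1 l] unfolding mult_1_left .
    show ?thesis
      by (rule minimiser_exists[OF strict[OF l] cont, of B]) (rule bspec[OF B])
  qed
  define U where "U l = (SOME u. minimises (\<lambda>v. N v + l * J v) u)" for l
  have U: "minimises (\<lambda>v. N v + l * J v) (U l)" if "0 \<le> l" "l < a" for l
    unfolding U_def by (rule someI_ex[OF ex[OF that]])
  have "minimises (\<lambda>v. N v + 0 * J v) (U 0)" by (rule U) (use a in linarith)+
  hence "N (U 0) + 0 * J (U 0) \<le> N z + 0 * J z" using z(1) unfolding minimises_def by blast
  hence "N (U 0) \<le> N z" by linarith
  hence start: "N (U 0) < r" using z(2) by linarith
  have "\<exists>l. 0 < l \<and> l < a \<and> N (U l) = r"
  proof (rule minimiser_path_attains[where U = U, OF a c N_conv N_cont P_conv J_cont _ start])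
    show "minimises (\<lambda>v. N v + l * J v) (U l)" if "0 \<le> l" "l < a" for l
      by (rule U[OF that])
    show "r < N u" if "minimises (\<lambda>v. N v + a * J v) u" for u
      by (rule end_above[OF that])
  qed
  then obtain l where l: "0 < l" "l < a" "N (U l) = r" by blast
  have Ul: "minimises (\<lambda>v. N v + l * J v) (U l)" by (rule U) (use l(1,2) in linarith)+
  have J_le: "J (U l) \<le> J v" if v: "v \<in> V" "N v = r" for v
  proof -
    have "N (U l) + l * J (U l) \<le> N v + l * J v" using Ul v(1) unfolding minimises_def by blast
    thus ?thesis using v l by simp
  qed
  have J_eq: "d (U l) v = 0" if v: "v \<in> V" "N v = r" "J v = J (U l)" for v
  proof -
    have eq: "N v + l * J v = N (U l) + l * J (U l)" unfolding v l(3) ..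
    have "minimises (\<lambda>v. N v + l * J v) v" using Ul v(1) unfolding minimises_def eq by blast
    with strict[OF less_imp_le[OF l(1)] l(2)] Ul show ?thesis by (rule minimiser_unique)
  qed
  show ?thesis
  proof (rule bexI)
    show "U l \<in> V" using Ul unfolding minimises_def by (rule conjunct1)
    show "N (U l) = r \<and> (\<forall>v\<in>V. N v = r \<longrightarrow> J (U l) \<le> J v \<and> (J v = J (U l) \<longrightarrow> d (U l) v = 0))"
      by (intro conjI ballI impI l(3) J_le J_eq)
  qed
qed

end

section \<open>Square integrable functions and completeness\<close>

definition sq_integrable :: "'a measure \<Rightarrow> ('a \<Rightarrow> 'b::euclidean_space) \<Rightarrow> bool" where
  "sq_integrable M h \<longleftrightarrow> h \<in> borel_measurable M \<and> integrable M (\<lambda>x. (norm (h x))\<^sup>2)"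

definition L2_dist :: "'a measure \<Rightarrow> ('a \<Rightarrow> 'b::euclidean_space) \<Rightarrow> ('a \<Rightarrow> 'b) \<Rightarrow> real" where
  "L2_dist M h k = sqrt (\<integral>x. (norm (h x - k x))\<^sup>2 \<partial>M)"

lemma L2_dist_sq: "(L2_dist M h k)\<^sup>2 = (\<integral>x. (norm (h x - k x))\<^sup>2 \<partial>M)"
  by (simp add: L2_dist_def)

lemma L2_dist_nonneg: "0 \<le> L2_dist M h k"
  by (simp add: L2_dist_def)

lemma L2_dist_commute: "L2_dist M h k = L2_dist M k h"
  by (simp add: L2_dist_def norm_minus_commute)

lemma norm_add_sq_le: "(norm (x + y))\<^sup>2 \<le> 2 * (norm x)\<^sup>2 + 2 * (norm (y::'a::real_inner))\<^sup>2"
proof -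
  have "(norm (x + y))\<^sup>2 + (norm (x - y))\<^sup>2 = 2 * (norm x)\<^sup>2 + 2 * (norm y)\<^sup>2"
    by (simp add: power2_norm_eq_inner inner_add_left inner_add_right inner_diff_left inner_diff_right)
  thus ?thesis using zero_le_power2[of "norm (x - y)"] by linarith
qed

text \<open>
  Young's inequality, used throughout in place of the Cauchy-Schwarz inequality for integrals.
\<close>

lemma mult_le_weighted_squares:
  assumes "0 < (e::real)"
  shows "2 * (x * y) \<le> e * x\<^sup>2 + y\<^sup>2 / e"
proof -
  define s where "s = sqrt e"
  have s: "0 < s" "e = s\<^sup>2" using assms by (simp_all add: s_def)
  have "0 \<le> (s * x - y / s)\<^sup>2" by simp
  moreover have "(s * x - y / s)\<^sup>2 = e * x\<^sup>2 + y\<^sup>2 / e - 2 * (x * y)"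
    using s by (simp add: power2_diff power_mult_distrib power_divide)
  ultimately show ?thesis by simp
qed

lemma le_one_plus_square: "x \<le> 1 + x\<^sup>2" for x :: real
proof -
  have "0 \<le> (x - 1 / 2)\<^sup>2" by simp
  also have "\<dots> = x\<^sup>2 - x + 1 / 4" by (simp add: power2_diff power_divide)
  finally show ?thesis by simp
qed

lemma sq_integrable_add:
  assumes "sq_integrable M h" "sq_integrable M k"
  shows "sq_integrable M (\<lambda>x. h x + k x)"
proof -
  have [measurable]: "h \<in> borel_measurable M" "k \<in> borel_measurable M"
    and i: "integrable M (\<lambda>x. 2 * (norm (h x))\<^sup>2 + 2 * (norm (k x))\<^sup>2)"
    using assms by (auto simp: sq_integrable_def)
  have "integrable M (\<lambda>x. (norm (h x + k x))\<^sup>2)"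
    by (rule Bochner_Integration.integrable_bound[OF i]) (auto simp: norm_add_sq_le)
  thus ?thesis by (simp add: sq_integrable_def)
qed

lemma sq_integrable_scale:
  assumes "sq_integrable M h"
  shows "sq_integrable M (\<lambda>x. c *\<^sub>R h x)"
  using assms by (auto simp: sq_integrable_def power_mult_distrib)

lemma sq_integrable_diff:
  assumes "sq_integrable M h" "sq_integrable M k"
  shows "sq_integrable M (\<lambda>x. h x - k x)"
  using sq_integrable_add[OF assms(1) sq_integrable_scale[OF assms(2), of "-1"]] by simp

lemma (in finite_measure) sq_integrable_imp_integrable:
  assumes "sq_integrable M h"
  shows "integrable M h"
proof -
  have [measurable]: "h \<in> borel_measurable M" and i: "integrable M (\<lambda>x. 1 + (norm (h x))\<^sup>2)"
    using assms by (auto simp: sq_integrable_def)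
  show ?thesis
  proof (rule Bochner_Integration.integrable_bound[OF i])
    show "AE x in M. norm (h x) \<le> norm (1 + (norm (h x))\<^sup>2)"
      using le_one_plus_square[of "norm (h x)" for x] by (intro AE_I2) simp
  qed simp
qed

lemma (in finite_measure) integrable_quadratic_growth:
  fixes U :: "'a \<Rightarrow> 'b::euclidean_space"
  assumes U: "sq_integrable M U" and F: "continuous_on UNIV F"
    and growth: "\<And>z. \<bar>F z\<bar> \<le> A + B * (norm z)\<^sup>2"
  shows "integrable M (\<lambda>x. F (U x) :: real)"
proof -
  have [measurable]: "U \<in> borel_measurable M" and i: "integrable M (\<lambda>x. A + B * (norm (U x))\<^sup>2)"
    using U by (auto simp: sq_integrable_def)
  have [measurable]: "F \<in> borel_measurable borel" using F by (rule borel_measurable_continuous_onI)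
  show ?thesis
  proof (rule Bochner_Integration.integrable_bound[OF i])
    show "AE x in M. norm (F (U x)) \<le> norm (A + B * (norm (U x))\<^sup>2)"
      using growth by (auto intro: order_trans[OF _ abs_ge_self])
  qed simp
qed

text \<open>
  On a finite measure space Young's inequality with weight \<open>2^k\<close> turns the bound \<open>4^-k\<close> on the squared
  norms into a bound of order \<open>2^-k\<close> on the integrals of the norms, which are therefore summable.
\<close>

lemma L2_Cauchy_AE_summable_subseq:
  fixes h :: "nat \<Rightarrow> 'a \<Rightarrow> 'b::euclidean_space"
  assumes fin: "finite_measure M" and h: "\<And>k. sq_integrable M (h k)"
    and fast: "\<And>k. (\<integral>x. (norm (h (Suc k) x - h k x))\<^sup>2 \<partial>M) \<le> (1 / 4) ^ k"
  shows "AE x in M. summable (\<lambda>k. norm (h (Suc k) x - h k x))"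
proof -
  interpret finite_measure M by fact
  define D where "D k x = h (Suc k) x - h k x" for k x
  have D: "sq_integrable M (D k)" for k unfolding D_def by (intro sq_integrable_diff h)
  hence Dm[measurable]: "D k \<in> borel_measurable M" for k by (simp add: sq_integrable_def)
  have Di: "integrable M (\<lambda>x. norm (D k x))" for k
    using sq_integrable_imp_integrable[OF D] by simp
  define c where "c = 1 + measure M (space M)"
  have bound: "(\<integral>x. norm (D k x) \<partial>M) \<le> c * (1 / 2) ^ k" for k
  proof -
    have "(\<integral>x. norm (D k x) \<partial>M) \<le> (\<integral>x. (1 / 2) ^ k + 2 ^ k * (norm (D k x))\<^sup>2 \<partial>M)"
    proof (rule integral_mono[OF Di])
      show "integrable M (\<lambda>x. (1 / 2) ^ k + 2 ^ k * (norm (D k x))\<^sup>2)"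
        using D[of k] by (auto simp: sq_integrable_def)
      show "norm (D k x) \<le> (1 / 2) ^ k + 2 ^ k * (norm (D k x))\<^sup>2" for x
      proof -
        have "2 * norm (D k x) \<le> (1 / 2) ^ k + 2 ^ k * (norm (D k x))\<^sup>2"
          using mult_le_weighted_squares[of "2 ^ k" "norm (D k x)" 1] by (simp add: power_one_over)
        thus ?thesis using norm_ge_zero[of "D k x"] by linarith
      qed
    qed
    also have "\<dots> = (1 / 2) ^ k * measure M (space M) + 2 ^ k * (\<integral>x. (norm (D k x))\<^sup>2 \<partial>M)"
      using D[of k] by (simp add: sq_integrable_def mult.commute)
    also have "\<dots> \<le> (1 / 2) ^ k * measure M (space M) + 2 ^ k * (1 / 4) ^ k"
      using fast[of k] by (simp add: D_def)
    also have "2 ^ k * (1 / 4) ^ k = (1 / 2 :: real) ^ k"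
      by (simp flip: power_mult_distrib)
    finally show ?thesis by (simp add: c_def algebra_simps)
  qed
  have "(\<integral>\<^sup>+x. (\<Sum>k. ennreal (norm (D k x))) \<partial>M) = (\<Sum>k. \<integral>\<^sup>+x. ennreal (norm (D k x)) \<partial>M)"
    by (rule nn_integral_suminf) simp
  also have "\<dots> \<le> (\<Sum>k. ennreal (c * (1 / 2) ^ k))"
  proof (intro suminf_le)
    show "(\<integral>\<^sup>+x. ennreal (norm (D k x)) \<partial>M) \<le> ennreal (c * (1 / 2) ^ k)" for k
      using ennreal_leI[OF bound[of k]] by (simp add: nn_integral_eq_integral[OF Di])
  qed auto
  also have "\<dots> < \<infinity>"
  proof -
    have "summable (\<lambda>k. c * (1 / 2 :: real) ^ k)" by (intro summable_mult summable_geometric) simp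
    thus ?thesis by (subst suminf_ennreal2) (auto simp: c_def)
  qed
  finally have "AE x in M. (\<Sum>k. ennreal (norm (D k x))) \<noteq> \<infinity>"
    by (intro nn_integral_PInf_AE) auto
  thus ?thesis
    unfolding D_def[symmetric]
    by eventually_elim (rule summable_suminf_not_top, auto)
qed

text \<open>
  Riesz-Fischer: a fast subsequence converges almost everywhere, and Fatou's lemma transfers the
  Cauchy estimates to the limit function.
\<close>

lemma L2_complete:
  fixes h :: "nat \<Rightarrow> 'a \<Rightarrow> 'b::euclidean_space"
  assumes fin: "finite_measure M" and h: "\<And>k. sq_integrable M (h k)"
    and cauchy: "\<And>e. 0 < e \<Longrightarrow> \<exists>N. \<forall>m\<ge>N. \<forall>n\<ge>m. L2_dist M (h m) (h n) < e"
  shows "\<exists>u. sq_integrable M u \<and> (\<lambda>k. L2_dist M (h k) u) \<longlonglongrightarrow> 0"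
proof -
  interpret finite_measure M by fact
  have hm[measurable]: "h k \<in> borel_measurable M" for k using h by (simp add: sq_integrable_def)
  have C: "\<exists>N. \<forall>m\<ge>N. \<forall>n\<ge>m. (\<integral>x. (norm (h n x - h m x))\<^sup>2 \<partial>M) \<le> e" if e: "0 < e" for e
  proof -
    obtain N where N: "\<forall>m\<ge>N. \<forall>n\<ge>m. L2_dist M (h m) (h n) < sqrt e"
      using cauchy[of "sqrt e"] e by auto
    have "(\<integral>x. (norm (h n x - h m x))\<^sup>2 \<partial>M) \<le> e" if "N \<le> m" "m \<le> n" for m n
      using N that by (auto simp: L2_dist_def norm_minus_commute intro: less_imp_le)
    thus ?thesis by blast
  qed
  have "\<exists>r. \<forall>k. (\<forall>m\<ge>r k. \<forall>n\<ge>m. (\<integral>x. (norm (h n x - h m x))\<^sup>2 \<partial>M) \<le> (1 / 4) ^ k) \<and> r k < r (Suc k)"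
  proof (rule dependent_nat_choice)
    show "\<exists>x. \<forall>m\<ge>x. \<forall>n\<ge>m. (\<integral>x. (norm (h n x - h m x))\<^sup>2 \<partial>M) \<le> (1 / 4) ^ 0" using C[of 1] by simp
    fix x k :: nat
    obtain N where N: "\<forall>m\<ge>N. \<forall>n\<ge>m. (\<integral>x. (norm (h n x - h m x))\<^sup>2 \<partial>M) \<le> (1 / 4) ^ Suc k"
      using C[of "(1 / 4) ^ Suc k"] by auto
    show "\<exists>y. (\<forall>m\<ge>y. \<forall>n\<ge>m. (\<integral>x. (norm (h n x - h m x))\<^sup>2 \<partial>M) \<le> (1 / 4) ^ Suc k) \<and> x < y"
      using N by (intro exI[of _ "max N (Suc x)"]) auto
  qed
  then obtain r where r: "\<And>k m n. r k \<le> m \<Longrightarrow> m \<le> n \<Longrightarrow> (\<integral>x. (norm (h n x - h m x))\<^sup>2 \<partial>M) \<le> (1 / 4) ^ k"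
    and rS: "\<And>k. r k < r (Suc k)" by blast
  have mono: "strict_mono r" using rS by (simp add: strict_mono_Suc_iff)
  have "AE x in M. summable (\<lambda>k. norm (h (r (Suc k)) x - h (r k) x))"
    by (rule L2_Cauchy_AE_summable_subseq[OF fin h], rule r[OF order_refl less_imp_le[OF rS]])
  hence conv: "AE x in M. convergent (\<lambda>k. h (r k) x)"
  proof eventually_elim
    fix x assume "summable (\<lambda>k. norm (h (r (Suc k)) x - h (r k) x))"
    hence "summable (\<lambda>k. h (r (Suc k)) x - h (r k) x)" by (rule summable_norm_cancel)
    hence "convergent (\<lambda>n. \<Sum>k<n. h (r (Suc k)) x - h (r k) x)" by (simp add: summable_iff_convergent)
    hence "convergent (\<lambda>n. h (r n) x - h (r 0) x)"
      using sum_lessThan_telescope[of "\<lambda>k. h (r k) x"] by simp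
    thus "convergent (\<lambda>n. h (r n) x)" by (simp add: convergent_diff_const_right_iff)
  qed
  define u where "u x = lim (\<lambda>k. h (r k) x)" for x
  have [measurable]: "u \<in> borel_measurable M" unfolding u_def by measurable
  have lim: "AE x in M. (\<lambda>k. h (r k) x) \<longlonglongrightarrow> u x"
    using conv by eventually_elim (simp add: u_def convergent_LIMSEQ_iff)
  have fatou: "(\<integral>\<^sup>+x. (norm (h m x - u x))\<^sup>2 \<partial>M) \<le> ennreal ((1 / 4) ^ k)" if m: "r k \<le> m" for m k
  proof -
    have "(\<integral>\<^sup>+x. (norm (h m x - u x))\<^sup>2 \<partial>M) = (\<integral>\<^sup>+x. liminf (\<lambda>j. ennreal ((norm (h (r j) x - h m x))\<^sup>2)) \<partial>M)"
    proof (rule nn_integral_cong_AE, use lim in eventually_elim)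
      fix x assume "(\<lambda>k. h (r k) x) \<longlonglongrightarrow> u x"
      hence "(\<lambda>j. ennreal ((norm (h (r j) x - h m x))\<^sup>2)) \<longlonglongrightarrow> ennreal ((norm (u x - h m x))\<^sup>2)"
        by (intro tendsto_intros tendsto_ennrealI)
      thus "ennreal ((norm (h m x - u x))\<^sup>2) = liminf (\<lambda>j. ennreal ((norm (h (r j) x - h m x))\<^sup>2))"
        by (subst norm_minus_commute) (rule lim_imp_Liminf[symmetric], simp_all)
    qed
    also have "\<dots> \<le> liminf (\<lambda>j. \<integral>\<^sup>+x. ennreal ((norm (h (r j) x - h m x))\<^sup>2) \<partial>M)"
      by (rule nn_integral_liminf) simp
    also have "\<dots> \<le> ennreal ((1 / 4) ^ k)"
    proof (rule Liminf_le)
      have "\<forall>\<^sub>F j in sequentially. m \<le> r j"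
        using mono filterlim_subseq[OF mono] by (auto simp: filterlim_at_top)
      thus "\<forall>\<^sub>F j in sequentially. (\<integral>\<^sup>+x. ennreal ((norm (h (r j) x - h m x))\<^sup>2) \<partial>M) \<le> ennreal ((1 / 4) ^ k)"
      proof eventually_elim
        fix j assume "m \<le> r j"
        moreover have "integrable M (\<lambda>x. (norm (h (r j) x - h m x))\<^sup>2)"
          using sq_integrable_diff[OF h h] by (simp add: sq_integrable_def)
        ultimately show "(\<integral>\<^sup>+x. ennreal ((norm (h (r j) x - h m x))\<^sup>2) \<partial>M) \<le> ennreal ((1 / 4) ^ k)"
          using r[OF m] by (simp add: nn_integral_eq_integral)
      qed
    qed simp
    finally show ?thesis .
  qed
  have sq: "sq_integrable M (\<lambda>x. h m x - u x)" if "r k \<le> m" for m k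
    unfolding sq_integrable_def using fatou[OF that]
    by (auto intro!: integrableI_bounded simp: less_top[symmetric] top_unique)
  have "sq_integrable M u"
    using sq_integrable_diff[OF h[of "r 0"] sq[OF order_refl, of 0]] by simp
  moreover have "(\<lambda>k. L2_dist M (h k) u) \<longlonglongrightarrow> 0"
  proof (rule LIMSEQ_I)
    fix e :: real assume e: "0 < e"
    have "(\<lambda>k. (1 / 4 :: real) ^ k) \<longlonglongrightarrow> 0" by (intro LIMSEQ_power_zero) simp
    then obtain k where k: "(1 / 4 :: real) ^ k < e\<^sup>2"
      using e order_tendstoD(2)[of _ 0 sequentially "e\<^sup>2"] eventually_sequentially by fastforce
    have "norm (L2_dist M (h m) u - 0) < e" if m: "r k \<le> m" for m
    proof -
      have "ennreal (\<integral>x. (norm (h m x - u x))\<^sup>2 \<partial>M) \<le> ennreal ((1 / 4) ^ k)"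
        using fatou[OF m] sq[OF m] by (simp add: sq_integrable_def nn_integral_eq_integral)
      hence "(\<integral>x. (norm (h m x - u x))\<^sup>2 \<partial>M) < e\<^sup>2" using k by simp
      hence "L2_dist M (h m) u < sqrt (e\<^sup>2)" unfolding L2_dist_def by (rule real_sqrt_less_mono)
      thus ?thesis using e by (simp add: L2_dist_nonneg)
    qed
    thus "\<exists>no. \<forall>n\<ge>no. norm (L2_dist M (h n) u - 0) < e" by blast
  qed
  ultimately show ?thesis by blast
qed

section \<open>Integral functionals of quadratic growth\<close>

text \<open>
  A growth condition on the increments that is stable under linear combinations and strong enough
  to make \<open>u \<mapsto> \<integral> F (u x)\<close> finite and continuous on square integrable functions. It covers functions
  with Lipschitzian gradient, the squared norm and products of two components.
\<close>

definition quadratic_modulus :: "('a::euclidean_space \<Rightarrow> real) \<Rightarrow> bool" where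
  "quadratic_modulus F \<longleftrightarrow> (\<exists>K\<ge>0. \<forall>z w.
     \<bar>F z - F w\<bar> \<le> K * (1 + norm w) * norm (z - w) + K * (norm (z - w))\<^sup>2)"

lemma quadratic_modulusI:
  fixes F :: "'a::euclidean_space \<Rightarrow> real"
  assumes "\<And>z w. \<bar>F z - F w\<bar> \<le> (A + B * norm w) * norm (z - w) + C * (norm (z - w))\<^sup>2"
  shows "quadratic_modulus F"
  unfolding quadratic_modulus_def
proof (intro exI[of _ "\<bar>A\<bar> + \<bar>B\<bar> + \<bar>C\<bar>"] conjI allI)
  fix z w :: 'a
  let ?K = "\<bar>A\<bar> + \<bar>B\<bar> + \<bar>C\<bar>"
  have "A \<le> ?K * 1" "B * norm w \<le> ?K * norm w" by (auto intro!: mult_right_mono)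
  hence "A + B * norm w \<le> ?K * (1 + norm w)" by (simp only: distrib_left)
  hence "(A + B * norm w) * norm (z - w) \<le> ?K * (1 + norm w) * norm (z - w)"
    by (rule mult_right_mono) simp
  moreover have "C * (norm (z - w))\<^sup>2 \<le> ?K * (norm (z - w))\<^sup>2" by (intro mult_right_mono) auto
  ultimately show "\<bar>F z - F w\<bar> \<le> ?K * (1 + norm w) * norm (z - w) + ?K * (norm (z - w))\<^sup>2"
    using assms[of z w] by linarith
qed simp

lemma quadratic_modulus_combination:
  fixes F G :: "'a::euclidean_space \<Rightarrow> real"
  assumes "quadratic_modulus F" "quadratic_modulus G"
  shows "quadratic_modulus (\<lambda>z. a * F z + b * G z)"
proof -
  obtain K where K: "0 \<le> K" "\<And>z w. \<bar>F z - F w\<bar> \<le> K * (1 + norm w) * norm (z - w) + K * (norm (z - w))\<^sup>2"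
    using assms(1) unfolding quadratic_modulus_def by blast
  obtain L where L: "0 \<le> L" "\<And>z w. \<bar>G z - G w\<bar> \<le> L * (1 + norm w) * norm (z - w) + L * (norm (z - w))\<^sup>2"
    using assms(2) unfolding quadratic_modulus_def by blast
  let ?C = "\<bar>a\<bar> * K + \<bar>b\<bar> * L"
  show ?thesis
  proof (rule quadratic_modulusI[of _ ?C ?C ?C])
    fix z w :: 'a
    have "\<bar>a * F z + b * G z - (a * F w + b * G w)\<bar> = \<bar>a * (F z - F w) + b * (G z - G w)\<bar>"
      by (simp add: algebra_simps)
    also have "\<dots> \<le> \<bar>a\<bar> * \<bar>F z - F w\<bar> + \<bar>b\<bar> * \<bar>G z - G w\<bar>"
      by (intro order_trans[OF abs_triangle_ineq]) (simp add: abs_mult)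
    also have "\<dots> \<le> \<bar>a\<bar> * (K * (1 + norm w) * norm (z - w) + K * (norm (z - w))\<^sup>2)
        + \<bar>b\<bar> * (L * (1 + norm w) * norm (z - w) + L * (norm (z - w))\<^sup>2)"
      by (intro add_mono mult_left_mono K(2) L(2)) auto
    also have "\<dots> = (?C + ?C * norm w) * norm (z - w) + ?C * (norm (z - w))\<^sup>2"
      by (simp add: algebra_simps)
    finally show "\<bar>a * F z + b * G z - (a * F w + b * G w)\<bar>
        \<le> (?C + ?C * norm w) * norm (z - w) + ?C * (norm (z - w))\<^sup>2" .
  qed
qed

lemma norm_sq_expand: "(norm z)\<^sup>2 = (norm w)\<^sup>2 + 2 * (w \<bullet> (z - w)) + (norm (z - w))\<^sup>2"
  for z w :: "'a::real_inner"
  by (simp add: power2_norm_eq_inner inner_diff_left inner_diff_right inner_commute)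

lemma quadratic_modulus_norm_sq: "quadratic_modulus (\<lambda>z::'a::euclidean_space. (norm z)\<^sup>2)"
proof (rule quadratic_modulusI[of _ 0 2 1])
  fix z w :: 'a
  have "\<bar>w \<bullet> (z - w)\<bar> \<le> norm w * norm (z - w)" by (rule Cauchy_Schwarz_ineq2)
  hence "\<bar>2 * (w \<bullet> (z - w)) + (norm (z - w))\<^sup>2\<bar> \<le> 2 * (norm w * norm (z - w)) + (norm (z - w))\<^sup>2"
    by (intro order_trans[OF abs_triangle_ineq]) simp
  thus "\<bar>(norm z)\<^sup>2 - (norm w)\<^sup>2\<bar> \<le> (0 + 2 * norm w) * norm (z - w) + 1 * (norm (z - w))\<^sup>2"
    unfolding norm_sq_expand[of z w] by (simp add: mult.assoc)
qed

lemma quadratic_modulus_lipschitz_grad: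
  fixes f :: "'a::euclidean_space \<Rightarrow> real"
  assumes df: "\<And>z. f differentiable (at z)" and lip: "C-lipschitz_on UNIV (grad f)"
  shows "quadratic_modulus f"
proof (rule quadratic_modulusI[of _ "norm (grad f 0)" C "C / 2"])
  fix z w :: 'a
  have "\<bar>grad f w \<bullet> (z - w)\<bar> \<le> norm (grad f w) * norm (z - w)" by (rule Cauchy_Schwarz_ineq2)
  also have "norm (grad f w) \<le> norm (grad f 0) + norm (grad f w - grad f 0)"
    using norm_triangle_ineq[of "grad f 0" "grad f w - grad f 0"] by simp
  also have "norm (grad f w - grad f 0) \<le> C * norm w"
    using lipschitz_onD[OF lip, of w 0] by (simp add: dist_norm)
  finally have "\<bar>grad f w \<bullet> (z - w)\<bar> \<le> (norm (grad f 0) + C * norm w) * norm (z - w)"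
    by (simp add: mult_right_mono)
  moreover have "\<bar>f z - f w\<bar> \<le> \<bar>grad f w \<bullet> (z - w)\<bar> + \<bar>f z - f w - grad f w \<bullet> (z - w)\<bar>"
    by arith
  ultimately show "\<bar>f z - f w\<bar> \<le> (norm (grad f 0) + C * norm w) * norm (z - w) + C / 2 * (norm (z - w))\<^sup>2"
    using lipschitz_grad_taylor[OF df lip, of z w] by linarith
qed

lemma quadratic_modulus_growth:
  assumes "quadratic_modulus F"
  obtains A B where "\<And>z. \<bar>F z\<bar> \<le> A + B * (norm z)\<^sup>2"
proof -
  obtain K where K: "0 \<le> K" "\<And>z w. \<bar>F z - F w\<bar> \<le> K * (1 + norm w) * norm (z - w) + K * (norm (z - w))\<^sup>2"
    using assms unfolding quadratic_modulus_def by blast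
  have "\<bar>F z\<bar> \<le> (\<bar>F 0\<bar> + K) + 2 * K * (norm z)\<^sup>2" for z
  proof -
    have "\<bar>F z - F 0\<bar> \<le> K * norm z + K * (norm z)\<^sup>2" using K(2)[of z 0] by simp
    moreover have "norm z \<le> 1 + (norm z)\<^sup>2"
by (rule le_one_plus_square)
    hence "K * norm z \<le> K * (1 + (norm z)\<^sup>2)" using K(1) by (rule mult_left_mono)
    hence "K * norm z \<le> K + K * (norm z)\<^sup>2" by (simp only: distrib_left mult_1_right)
    moreover have "\<bar>F z\<bar> \<le> \<bar>F 0\<bar> + \<bar>F z - F 0\<bar>" by arith
    ultimately show ?thesis by linarith
  qed
  thus ?thesis using that by blast
qed

lemma quadratic_modulus_continuous:
  assumes "quadratic_modulus F"
  shows "continuous_on UNIV F"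
proof -
  obtain K where K: "\<And>z w. \<bar>F z - F w\<bar> \<le> K * (1 + norm w) * norm (z - w) + K * (norm (z - w))\<^sup>2"
    using assms unfolding quadratic_modulus_def by blast
  have "(F \<longlongrightarrow> F w) (at w)" for w
  proof (rule Lim_transform_bound[where g = "\<lambda>z. K * (1 + norm w) * norm (z - w) + K * (norm (z - w))\<^sup>2", THEN LIM_zero_cancel])
    show "\<forall>\<^sub>F z in at w. norm (F z - F w) \<le> norm (K * (1 + norm w) * norm (z - w) + K * (norm (z - w))\<^sup>2)"
      using K[of _ w] by (intro always_eventually allI) (auto intro: order_trans[OF _ abs_ge_self])
    have "((\<lambda>z. K * (1 + norm w) * norm (z - w) + K * (norm (z - w))\<^sup>2) \<longlongrightarrow>
        K * (1 + norm w) * norm (w - w) + K * (norm (w - w))\<^sup>2) (at w)"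
      by (intro tendsto_intros)
    thus "((\<lambda>z. K * (1 + norm w) * norm (z - w) + K * (norm (z - w))\<^sup>2) \<longlongrightarrow> 0) (at w)" by simp
  qed
  thus ?thesis by (simp add: continuous_on_def)
qed

lemma (in finite_measure) integrable_quadratic_modulus:
  assumes "quadratic_modulus F" "sq_integrable M U"
  shows "integrable M (\<lambda>x. F (U x))"
proof -
  obtain A B where "\<And>z. \<bar>F z\<bar> \<le> A + B * (norm z)\<^sup>2"
    using quadratic_modulus_growth[OF assms(1)] by blast
  thus ?thesis by (rule integrable_quadratic_growth[OF assms(2) quadratic_modulus_continuous[OF assms(1)]])
qed

lemma (in finite_measure) integral_functional_midpoint:
  assumes F: "quadratic_modulus F" and U: "sq_integrable M U" and W: "sq_integrable M W"
    and conv: "\<And>z w. 2 * F ((1 / 2) *\<^sub>R (z + w)) + c * (norm (z - w))\<^sup>2 \<le> F z + F w"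
  shows "2 * (\<integral>x. F ((1 / 2) *\<^sub>R (U x + W x)) \<partial>M) + c * (L2_dist M U W)\<^sup>2
     \<le> (\<integral>x. F (U x) \<partial>M) + (\<integral>x. F (W x) \<partial>M)"
proof -
  have iU: "integrable M (\<lambda>x. F (U x))" and iW: "integrable M (\<lambda>x. F (W x))"
    and im: "integrable M (\<lambda>x. F ((1 / 2) *\<^sub>R (U x + W x)))"
    by (intro integrable_quadratic_modulus F U W sq_integrable_add sq_integrable_scale)+
  have id: "integrable M (\<lambda>x. (norm (U x - W x))\<^sup>2)"
    using sq_integrable_diff[OF U W] by (simp add: sq_integrable_def)
  have "2 * (\<integral>x. F ((1 / 2) *\<^sub>R (U x + W x)) \<partial>M) + c * (L2_dist M U W)\<^sup>2
     = (\<integral>x. 2 * F ((1 / 2) *\<^sub>R (U x + W x)) + c * (norm (U x - W x))\<^sup>2 \<partial>M)"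
    using im id by (simp add: L2_dist_sq)
  also have "\<dots> \<le> (\<integral>x. F (U x) + F (W x) \<partial>M)"
    using im id iU iW by (intro integral_mono conv) auto
  also have "\<dots> = (\<integral>x. F (U x) \<partial>M) + (\<integral>x. F (W x) \<partial>M)" using iU iW by simp
  finally show ?thesis .
qed

text \<open>
  Young's inequality with a small weight \<open>e\<close> on the factor that depends on the limit only: the
  difference is at most \<open>e\<close> times a constant plus a multiple, depending on \<open>e\<close>, of the squared distance.
\<close>

lemma (in finite_measure) integral_functional_continuous:
  assumes F: "quadratic_modulus F" and U: "\<And>k::nat. sq_integrable M (U k)" and W: "sq_integrable M W"
    and lim: "(\<lambda>k. L2_dist M (U k) W) \<longlonglongrightarrow> 0"
  shows "(\<lambda>k. \<integral>x. F (U k x) \<partial>M) \<longlonglongrightarrow> (\<integral>x. F (W x) \<partial>M)"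
proof (rule LIMSEQ_I)
  fix \<epsilon> :: real assume \<epsilon>: "0 < \<epsilon>"
  obtain K where K: "0 \<le> K" "\<And>z w. \<bar>F z - F w\<bar> \<le> K * (1 + norm w) * norm (z - w) + K * (norm (z - w))\<^sup>2"
    using F unfolding quadratic_modulus_def by blast
  define G where "G w = (K * (1 + norm w))\<^sup>2" for w :: 'b
  have [measurable]: "U k \<in> borel_measurable M" "W \<in> borel_measurable M" for k
    using U W by (simp_all add: sq_integrable_def)
  have Gi: "integrable M (\<lambda>x. G (W x))"
  proof (rule integrable_quadratic_growth[OF W])
    show "continuous_on UNIV G" unfolding G_def by (intro continuous_intros)
    show "\<bar>G z\<bar> \<le> 2 * K\<^sup>2 + 2 * K\<^sup>2 * (norm z)\<^sup>2" for z
    proof -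
      have "(1 + norm z)\<^sup>2 \<le> 2 * 1 + 2 * (norm z)\<^sup>2" using norm_add_sq_le[of 1 "norm z"] by simp
      hence "K\<^sup>2 * (1 + norm z)\<^sup>2 \<le> K\<^sup>2 * (2 * 1 + 2 * (norm z)\<^sup>2)" by (intro mult_left_mono) auto
      thus ?thesis unfolding G_def power_mult_distrib by (simp add: distrib_left mult.assoc)
    qed
  qed
  define Q where "Q = (\<integral>x. G (W x) \<partial>M)"
  have Q: "0 \<le> Q" unfolding Q_def G_def by simp
  (* the weight that makes the term independent of k at most \<epsilon>; Q itself may vanish *)
  define e where "e = \<epsilon> / (Q + 1)"
  have e: "0 < e" "e * Q \<le> \<epsilon>" using \<epsilon> Q by (auto simp: e_def field_simps)
  define H where "H = 1 / e + 2 * K"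
  have H: "0 < H" using e K by (simp add: H_def add_pos_nonneg)
  have est: "2 * \<bar>(\<integral>x. F (U k x) \<partial>M) - (\<integral>x. F (W x) \<partial>M)\<bar> \<le> e * Q + H * (L2_dist M (U k) W)\<^sup>2" for k
  proof -
    have i: "integrable M (\<lambda>x. F (U k x))" "integrable M (\<lambda>x. F (W x))"
      by (intro integrable_quadratic_modulus F U W)+
    have id: "integrable M (\<lambda>x. (norm (U k x - W x))\<^sup>2)"
      using sq_integrable_diff[OF U W] by (simp add: sq_integrable_def)
    have "2 * \<bar>(\<integral>x. F (U k x) \<partial>M) - (\<integral>x. F (W x) \<partial>M)\<bar> = 2 * \<bar>\<integral>x. F (U k x) - F (W x) \<partial>M\<bar>"
      using i by simp
    also have "\<dots> \<le> 2 * (\<integral>x. \<bar>F (U k x) - F (W x)\<bar> \<partial>M)"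
      using integral_norm_bound[of M "\<lambda>x. F (U k x) - F (W x)"] by simp
    also have "\<dots> = (\<integral>x. 2 * \<bar>F (U k x) - F (W x)\<bar> \<partial>M)" by simp
    also have "\<dots> \<le> (\<integral>x. e * G (W x) + H * (norm (U k x - W x))\<^sup>2 \<partial>M)"
    proof (rule integral_mono)
      show "integrable M (\<lambda>x. 2 * \<bar>F (U k x) - F (W x)\<bar>)" using i by auto
      show "integrable M (\<lambda>x. e * G (W x) + H * (norm (U k x - W x))\<^sup>2)" using Gi id by auto
      fix x
      define y where "y = (norm (U k x - W x))\<^sup>2"
      define p where "p = K * (1 + norm (W x)) * norm (U k x - W x)"
      have "2 * \<bar>F (U k x) - F (W x)\<bar> \<le> 2 * p + 2 * (K * y)"
        using K(2)[of "U k x" "W x"] by (simp add: p_def y_def)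
      moreover have "2 * (K * (1 + norm (W x)) * norm (U k x - W x))
          \<le> e * G (W x) + (norm (U k x - W x))\<^sup>2 / e"
        unfolding G_def by (rule mult_le_weighted_squares[OF e(1)])
      moreover have "H * (norm (U k x - W x))\<^sup>2
          = (norm (U k x - W x))\<^sup>2 / e + 2 * (K * (norm (U k x - W x))\<^sup>2)"
        by (simp add: H_def algebra_simps)
      ultimately show "2 * \<bar>F (U k x) - F (W x)\<bar> \<le> e * G (W x) + H * (norm (U k x - W x))\<^sup>2"
        unfolding y_def[symmetric] p_def[symmetric] by linarith
    qed
    also have "\<dots> = e * Q + H * (L2_dist M (U k) W)\<^sup>2"
      using Gi id by (simp add: Q_def L2_dist_sq)
    finally show ?thesis .
  qed
  have "(\<lambda>k. H * (L2_dist M (U k) W)\<^sup>2) \<longlonglongrightarrow> H * 0\<^sup>2" by (intro tendsto_intros lim)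
  hence "(\<lambda>k. H * (L2_dist M (U k) W)\<^sup>2) \<longlonglongrightarrow> 0" by simp
  hence "\<forall>\<^sub>F k in sequentially. H * (L2_dist M (U k) W)\<^sup>2 < \<epsilon>" using \<epsilon> by (rule order_tendstoD(2))
  then obtain N where N: "\<And>k. N \<le> k \<Longrightarrow> H * (L2_dist M (U k) W)\<^sup>2 < \<epsilon>"
    unfolding eventually_sequentially by blast
  have "norm ((\<integral>x. F (U k x) \<partial>M) - (\<integral>x. F (W x) \<partial>M)) < \<epsilon>" if "N \<le> k" for k
    using est[of k] N[OF that] e(2) by simp
  thus "\<exists>N. \<forall>k\<ge>N. norm ((\<integral>x. F (U k x) \<partial>M) - (\<integral>x. F (W x) \<partial>M)) < \<epsilon>" by blast
qed

section \<open>Smooth bump functions supported in boxes\<close>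

text \<open>
  The model of a smooth function that is flat at \<open>0\<close>. The polynomial factor in \<open>1/t\<close> makes the family
  closed under differentiation.
\<close>

definition flat :: "real poly \<Rightarrow> real \<Rightarrow> real" where
  "flat p t = (if 0 < t then poly p (inverse t) * exp (- inverse t) else 0)"

definition flat_deriv :: "real poly \<Rightarrow> real poly" where
  "flat_deriv p = [:0, 0, 1:] * (p - pderiv p)"

lemma poly_mult_exp_neg_tendsto_0: "((\<lambda>s::real. poly p s * exp (- s)) \<longlongrightarrow> 0) at_top"
proof -
  have "((\<lambda>s. \<Sum>i\<le>degree p. coeff p i * (s ^ i / exp s)) \<longlongrightarrow> (\<Sum>i\<le>degree p. coeff p i * 0)) at_top"
    by (intro tendsto_sum tendsto_mult tendsto_const tendsto_power_div_exp_0)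
  moreover have "(\<Sum>i\<le>degree p. coeff p i * (s ^ i / exp s)) = poly p s * exp (- s)" for s
    by (simp add: poly_altdef sum_distrib_right exp_minus divide_inverse mult.assoc)
  ultimately show ?thesis by simp
qed

text \<open>
  Away from \<open>0\<close> this is the product rule; at \<open>0\<close> the exponential beats every polynomial in \<open>1/t\<close>.
\<close>

lemma flat_has_derivative: "(flat p has_real_derivative flat (flat_deriv p) t) (at t)"
proof -
  consider "0 < t" | "t < 0" | "t = 0" by linarith
  thus ?thesis
  proof cases
    case 1
    have "((\<lambda>t. poly p (inverse t) * exp (- inverse t)) has_real_derivative flat (flat_deriv p) t) (at t)"
      using 1 by (auto intro!: derivative_eq_intros poly_DERIV[THEN DERIV_chain2]
          simp: flat_def flat_deriv_def power2_eq_square algebra_simps)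
    thus ?thesis
      by (rule has_field_derivative_transform_within_open[of _ _ _ "{0<..}"]) (use 1 in \<open>auto simp: flat_def\<close>)
  next
    case 2
    have "((\<lambda>t. 0) has_real_derivative flat (flat_deriv p) t) (at t)"
      using 2 by (simp add: flat_def)
    thus ?thesis
      by (rule has_field_derivative_transform_within_open[of _ _ _ "{..<0}"]) (use 2 in \<open>auto simp: flat_def\<close>)
  next
    case 3
    have "((\<lambda>h. flat p h / h) \<longlongrightarrow> 0) (at 0)"
      unfolding filterlim_at_split
    proof
      have "\<forall>\<^sub>F h in at_left 0. 0 = flat p h / h"
        by (auto simp: eventually_at_filter flat_def)
      thus "((\<lambda>h. flat p h / h) \<longlongrightarrow> 0) (at_left 0)"
        by (rule Lim_transform_eventually[OF tendsto_const])
      have "((\<lambda>h. poly ([:0, 1:] * p) (inverse h) * exp (- inverse h)) \<longlongrightarrow> 0) (at_right 0)"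
        by (rule filterlim_compose[OF poly_mult_exp_neg_tendsto_0 filterlim_inverse_at_top_right])
      moreover have "\<forall>\<^sub>F h in at_right 0. poly ([:0, 1:] * p) (inverse h) * exp (- inverse h) = flat p h / h"
        by (auto simp: eventually_at_filter flat_def divide_inverse)
      ultimately show "((\<lambda>h. flat p h / h) \<longlongrightarrow> 0) (at_right 0)"
        by (rule Lim_transform_eventually)
    qed
    thus ?thesis unfolding 3 has_field_derivative_iff by (simp add: flat_def)
  qed
qed

text \<open>
  An algebra of functions closed under partial derivatives. All iterated derivatives of its members
  then exist without being computed.
\<close>

inductive bump_algebra :: "('a::euclidean_space \<Rightarrow> real) \<Rightarrow> bool" where
  const: "bump_algebra (\<lambda>x. c)"
| flat: "bump_algebra (\<lambda>x. flat p (l \<bullet> x + c))"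
| add: "bump_algebra \<phi> \<Longrightarrow> bump_algebra \<psi> \<Longrightarrow> bump_algebra (\<lambda>x. \<phi> x + \<psi> x)"
| mult: "bump_algebra \<phi> \<Longrightarrow> bump_algebra \<psi> \<Longrightarrow> bump_algebra (\<lambda>x. \<phi> x * \<psi> x)"

lemma bump_algebra_gradient:
  "bump_algebra \<phi> \<Longrightarrow> \<exists>G. (\<forall>z. GDERIV \<phi> z :> G z) \<and> (\<forall>b. bump_algebra (\<lambda>z. G z \<bullet> b))"
proof (induction rule: bump_algebra.induct)
  case (const c)
  show ?case by (intro exI[of _ "\<lambda>z. 0"]) (auto intro: GDERIV_const bump_algebra.const)
next
  case (flat p l c)
  have "GDERIV (\<lambda>x. flat p (l \<bullet> x + c)) z :> flat (flat_deriv p) (l \<bullet> z + c) *\<^sub>R l" for z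
  proof (rule GDERIV_DERIV_compose[where f = "\<lambda>x. l \<bullet> x + c" and g = "flat p"])
    show "GDERIV (\<lambda>x. l \<bullet> x + c) z :> l"
      unfolding GDERIV_iff by (auto intro!: derivative_eq_intros simp: inner_commute)
  qed (rule flat_has_derivative)
  moreover have "bump_algebra (\<lambda>z. (flat (flat_deriv p) (l \<bullet> z + c) *\<^sub>R l) \<bullet> b)" for b
    unfolding inner_scaleR_left by (intro bump_algebra.intros)
  ultimately show ?case by (intro exI[of _ "\<lambda>z. flat (flat_deriv p) (l \<bullet> z + c) *\<^sub>R l"]) blast
next
  case (add \<phi> \<psi>)
  then obtain G H where GH: "\<And>z. GDERIV \<phi> z :> G z" "\<And>b. bump_algebra (\<lambda>z. G z \<bullet> b)"
    "\<And>z. GDERIV \<psi> z :> H z" "\<And>b. bump_algebra (\<lambda>z. H z \<bullet> b)" by blast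
  have "GDERIV (\<lambda>x. \<phi> x + \<psi> x) z :> G z + H z" for z by (intro GDERIV_add GH)
  moreover have "bump_algebra (\<lambda>z. (G z + H z) \<bullet> b)" for b
    unfolding inner_add_left by (intro bump_algebra.intros GH)
  ultimately show ?case by (intro exI[of _ "\<lambda>z. G z + H z"]) blast
next
  case (mult \<phi> \<psi>)
  then obtain G H where GH: "\<And>z. GDERIV \<phi> z :> G z" "\<And>b. bump_algebra (\<lambda>z. G z \<bullet> b)"
    "\<And>z. GDERIV \<psi> z :> H z" "\<And>b. bump_algebra (\<lambda>z. H z \<bullet> b)" by blast
  have "GDERIV (\<lambda>x. \<phi> x * \<psi> x) z :> \<phi> z *\<^sub>R H z + \<psi> z *\<^sub>R G z" for z by (intro GDERIV_mult GH)
  moreover have "bump_algebra (\<lambda>z. (\<phi> z *\<^sub>R H z + \<psi> z *\<^sub>R G z) \<bullet> b)" for b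
    unfolding inner_add_left inner_scaleR_left by (intro bump_algebra.intros GH mult.hyps)
  ultimately show ?case by (intro exI[of _ "\<lambda>z. \<phi> z *\<^sub>R H z + \<psi> z *\<^sub>R G z"]) blast
qed

lemma bump_algebra_C_k: "bump_algebra \<phi> \<Longrightarrow> C_k k \<phi>"
proof (induction k arbitrary: \<phi>)
  case (Suc k)
  obtain G where G: "\<And>z. GDERIV \<phi> z :> G z" "\<And>b. bump_algebra (\<lambda>z. G z \<bullet> b)"
    using bump_algebra_gradient[OF Suc.prems] by blast
  have "grad \<phi> = G" using grad_eqI[OF G(1)] by blast
  moreover have "\<phi> differentiable (at z)" for z
    using G(1)[of z] unfolding GDERIV_iff differentiable_def by blast
  ultimately show ?case using Suc.IH[OF G(2)] by simp
next
  case 0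
  obtain G where G: "\<And>z. GDERIV \<phi> z :> G z"
    using bump_algebra_gradient[OF 0] by blast
  hence "isCont \<phi> z" for z unfolding GDERIV_iff using has_derivative_continuous by blast
  thus ?case by (simp add: continuous_at_imp_continuous_on)
qed

lemma bump_algebra_prod:
  "finite A \<Longrightarrow> (\<And>i. i \<in> A \<Longrightarrow> bump_algebra (\<phi> i)) \<Longrightarrow> bump_algebra (\<lambda>x. \<Prod>i\<in>A. \<phi> i x)"
  by (induction rule: finite_induct) (auto intro: bump_algebra.intros)

text \<open>
  For \<open>t > 0\<close> the function \<open>flat 1 (s t) = exp (- 1 / (s t))\<close> tends to \<open>1\<close> as \<open>s\<close> tends to infinity, so
  these bumps converge to the indicator function of the box.
\<close>

definition box_bump :: "real^'n \<Rightarrow> real^'n \<Rightarrow> real \<Rightarrow> real^'n \<Rightarrow> real" where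
  "box_bump a b s x = (\<Prod>i\<in>UNIV. flat 1 (s * (x $ i - a $ i)) * flat 1 (s * (b $ i - x $ i)))"

lemma flat_1: "flat 1 t = (if 0 < t then exp (- inverse t) else 0)"
  by (simp add: flat_def)

lemma flat_1_bounds: "0 \<le> flat 1 t" "flat 1 t \<le> 1"
  by (simp_all add: flat_1)

lemma box_bump_bounds: "0 \<le> box_bump a b s x" "box_bump a b s x \<le> 1"
  unfolding box_bump_def
  by (auto intro!: prod_nonneg prod_le_1 mult_le_one mult_nonneg_nonneg flat_1_bounds)

lemma box_bump_nonzero:
  assumes "0 < s"
  shows "box_bump a b s x \<noteq> 0 \<longleftrightarrow> x \<in> box a b"
  using assms unfolding box_bump_def flat_1 by (auto simp: mem_box_cart zero_less_mult_iff)

lemma box_bump_test_fun: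
  assumes "0 < s" "cbox a b \<subseteq> \<Omega>"
  shows "test_fun \<Omega> (box_bump a b s)"
proof -
  have "bump_algebra (\<lambda>x. flat 1 (s * (x $ i - a $ i)) * flat 1 (s * (b $ i - x $ i)))" for i
  proof -
    have "s * (x $ i - a $ i) = (s *\<^sub>R axis i 1) \<bullet> x + (- s * a $ i)"
      "s * (b $ i - x $ i) = (- s *\<^sub>R axis i 1) \<bullet> x + s * b $ i" for x
      by (simp_all add: inner_axis' algebra_simps)
    thus ?thesis by (simp only:) (intro bump_algebra.intros)
  qed
  hence "bump_algebra (box_bump a b s)" unfolding box_bump_def[abs_def] by (intro bump_algebra_prod) auto
  moreover have sub: "closure {x. box_bump a b s x \<noteq> 0} \<subseteq> cbox a b"
    using box_bump_nonzero[OF assms(1), of a b] box_subset_cbox[of a b] by (intro closure_minimal) auto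
  moreover have "compact (closure {x. box_bump a b s x \<noteq> 0})"
    using bounded_subset[OF bounded_cbox sub] by (simp add: compact_eq_bounded_closed)
  ultimately show ?thesis using assms(2) bump_algebra_C_k unfolding test_fun_def by blast
qed

lemma box_bump_tendsto_indicator:
  "(\<lambda>k. box_bump a b (real (Suc k)) x) \<longlonglongrightarrow> indicator (box a b) x"
proof (cases "x \<in> box a b")
  case True
  have lim: "(\<lambda>k. flat 1 (real (Suc k) * t)) \<longlonglongrightarrow> 1" if t: "0 < t" for t
  proof -
    have "(\<lambda>k. exp (- (inverse (real (Suc k)) * inverse t))) \<longlonglongrightarrow> exp (- (0 * inverse t))"
      by (intro tendsto_intros LIMSEQ_inverse_real_of_nat)
    thus ?thesis using t by (simp add: flat_1 zero_less_mult_iff)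
  qed
  have "(\<lambda>k. box_bump a b (real (Suc k)) x) \<longlonglongrightarrow> (\<Prod>i\<in>(UNIV::'a set). 1 * 1)"
    unfolding box_bump_def using True by (intro tendsto_prod tendsto_mult lim) (auto simp: mem_box_cart)
  thus ?thesis using True by simp
next
  case False
  hence "box_bump a b (real (Suc k)) x = 0" for k using box_bump_nonzero[of "real (Suc k)" a b x] by auto
  thus ?thesis using False by simp
qed

section \<open>The fundamental lemma of the calculus of variations\<close>

text \<open>
  Boxes are stable under intersection and generate the Borel sets, so by Dynkin's argument all set
  integrals vanish.
\<close>

lemma integrable_AE_zero_if_box_integrals_zero:
  fixes H :: "'a::euclidean_space \<Rightarrow> real"
  assumes H: "integrable lborel H"
    and box: "\<And>a b. (\<integral>x. indicator (box a b) x * H x \<partial>lborel) = 0"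
    and total: "(\<integral>x. H x \<partial>lborel) = 0"
  shows "AE x in lborel. H x = 0"
proof (rule sigma_finite_measure.density_zero[OF sigma_finite_lborel H])
  fix A :: "'a set" assume "A \<in> sets lborel"
  hence A: "A \<in> sigma_sets UNIV (range (\<lambda>(a, b). box a b :: 'a set))"
    by (simp add: borel_eq_box)
  have stable: "Int_stable (range (\<lambda>(a, b). box a b :: 'a set))"
    unfolding Int_stable_def by (auto simp: box_Int_box)
  have subset_Pow_UNIV: "range (\<lambda>(a, b). box a b :: 'a set) \<subseteq> Pow UNIV" by simp
  have meas: "X \<in> sets borel" if "X \<in> sigma_sets UNIV (range (\<lambda>(a, b). box a b :: 'a set))" for X
    using that by (simp add: borel_eq_box)
  have int: "set_integrable lborel X H" if "X \<in> sets borel" for X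
    using that H integrable_mult_indicator[of X lborel H] by (simp add: set_integrable_def)
  show "set_lebesgue_integral lborel A H = 0"
    using stable subset_Pow_UNIV A
  proof (induction rule: sigma_sets_induct_disjoint)
    case (basic X)
    thus ?case using box by (auto simp: set_lebesgue_integral_def)
  next
    case empty
    show ?case by (simp add: set_lebesgue_integral_def)
  next
    case (compl X)
    have "set_lebesgue_integral lborel (X \<union> (UNIV - X)) H
        = set_lebesgue_integral lborel X H + set_lebesgue_integral lborel (UNIV - X) H"
      using meas[OF compl.hyps] by (intro set_integral_Un int) auto
    moreover have "set_lebesgue_integral lborel (X \<union> (UNIV - X)) H = 0"
      using total by (simp add: set_lebesgue_integral_def)
    ultimately show ?case using compl.IH by simp
  next
    case (union X)
    have X: "X i \<in> sets borel" for i using union.hyps(2) meas by blast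
    have "set_lebesgue_integral lborel (\<Union>i. X i) H = (\<Sum>i. set_lebesgue_integral lborel (X i) H)"
      using X union.hyps(1)
      by (intro lebesgue_integral_countable_add int) (auto simp: disjoint_family_on_def)
    thus ?case using union.IH by simp
  qed
qed

text \<open>
  Testing with box bumps and passing to the limit by dominated convergence, the integrals of \<open>h\<close> over
  boxes with closure inside \<open>\<Omega>\<close> vanish. Localising to one such box makes the integrals over all boxes
  available, and countably many boxes cover \<open>\<Omega>\<close>.
\<close>

lemma fundamental_lemma_calculus_of_variations:
  fixes \<Omega> :: "(real^'n) set" and h :: "real^'n \<Rightarrow> real"
  assumes \<Omega>: "open \<Omega>" and h: "integrable (lebesgue_on \<Omega>) h"
    and test: "\<And>\<phi>. test_fun \<Omega> \<phi> \<Longrightarrow> (\<integral>x. h x * \<phi> x \<partial>lebesgue_on \<Omega>) = 0"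
  shows "AE x in lebesgue_on \<Omega>. h x = 0"
proof -
  have \<Omega>m: "\<Omega> \<in> sets lebesgue" using \<Omega> by simp
  have [measurable]: "h \<in> borel_measurable (lebesgue_on \<Omega>)" using h by blast
  have box_meas: "(\<lambda>x. indicator (box a b) x :: real) \<in> borel_measurable (lebesgue_on \<Omega>)" for a b :: "real^'n"
    by (intro measurable_restrict_space1 measurable_completion) simp
  have bump_meas: "box_bump a b s \<in> borel_measurable (lebesgue_on \<Omega>)" if "0 < s" for a b :: "real^'n" and s
  proof -
    have "C_k 0 (box_bump a b s)"
      using box_bump_test_fun[OF that, of a b UNIV] unfolding test_fun_def by blast
    hence "box_bump a b s \<in> borel_measurable borel" by (simp add: borel_measurable_continuous_onI)
    thus ?thesis by (intro measurable_restrict_space1 measurable_completion) simp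
  qed
  have box0: "(\<integral>x. h x * indicator (box a b) x \<partial>lebesgue_on \<Omega>) = 0" if sub: "cbox a b \<subseteq> \<Omega>" for a b
  proof -
    have "(\<lambda>k. \<integral>x. h x * box_bump a b (real (Suc k)) x \<partial>lebesgue_on \<Omega>)
        \<longlonglongrightarrow> (\<integral>x. h x * indicator (box a b) x \<partial>lebesgue_on \<Omega>)"
    proof (rule integral_dominated_convergence[where w = "\<lambda>x. norm (h x)"])
      show "(\<lambda>x. h x * indicator (box a b) x) \<in> borel_measurable (lebesgue_on \<Omega>)"
        using box_meas by measurable
      show "(\<lambda>x. h x * box_bump a b (real (Suc k)) x) \<in> borel_measurable (lebesgue_on \<Omega>)" for k
        using bump_meas[of "real (Suc k)" a b] by measurable
      show "integrable (lebesgue_on \<Omega>) (\<lambda>x. norm (h x))" using h by simp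
      show "AE x in lebesgue_on \<Omega>. (\<lambda>k. h x * box_bump a b (real (Suc k)) x) \<longlonglongrightarrow> h x * indicator (box a b) x"
        by (intro AE_I2 tendsto_mult tendsto_const box_bump_tendsto_indicator)
      show "AE x in lebesgue_on \<Omega>. norm (h x * box_bump a b (real (Suc k)) x) \<le> norm (h x)" for k
      proof (intro AE_I2)
        fix x
        have "\<bar>h x\<bar> * box_bump a b (real (Suc k)) x \<le> \<bar>h x\<bar> * 1"
          by (intro mult_left_mono box_bump_bounds) simp
        thus "norm (h x * box_bump a b (real (Suc k)) x) \<le> norm (h x)"
          using box_bump_bounds(1)[of a b "real (Suc k)" x] by (simp add: abs_mult)
      qed
    qed
    moreover have "(\<integral>x. h x * box_bump a b (real (Suc k)) x \<partial>lebesgue_on \<Omega>) = 0" for k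
      by (intro test box_bump_test_fun sub) simp
    ultimately show ?thesis by (simp add: LIMSEQ_const_iff)
  qed
  have local: "AE x in lebesgue. x \<in> cbox c d \<longrightarrow> h x = 0" if sub: "cbox c d \<subseteq> \<Omega>" for c d
  proof -
    define H where "H x = indicator \<Omega> x *\<^sub>R (h x * indicator (box c d) x)" for x
    have Hm: "integrable lebesgue H"
    proof -
      have "integrable (lebesgue_on \<Omega>) (\<lambda>x. h x * indicator (box c d) x)"
        using h box_meas[of c d]
        by (intro Bochner_Integration.integrable_bound[OF h]) (auto simp: indicator_def)
      thus ?thesis unfolding H_def using \<Omega>m by (subst (asm) integrable_restrict_space) auto
    qed
    have Hbox: "(\<integral>x. indicator (box a b) x * H x \<partial>lebesgue) = 0" for a b
    proof -
      (* a box enters only through its part inside the box from c to d, again a box, whose closure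
         lies in the domain unless it is empty *)
      obtain p q where pq: "box c d \<inter> box a b = box p q" by (simp add: box_Int_box)
      have pq_sub: "cbox p q \<subseteq> \<Omega> \<or> box p q = {}"
      proof (cases "box p q = {}")
        case False
        have "cbox p q \<subseteq> closure (box c d)" using pq closure_box[OF False] by (metis Int_lower1 closure_mono)
        thus ?thesis using sub closure_minimal[OF box_subset_cbox closed_cbox] by blast
      qed simp
      have "(\<integral>x. indicator (box a b) x * H x \<partial>lebesgue)
          = (\<integral>x. indicator \<Omega> x *\<^sub>R (h x * indicator (box p q) x) \<partial>lebesgue)"
        unfolding H_def pq[symmetric] by (intro Bochner_Integration.integral_cong) (auto simp: indicator_def)
      also have "\<dots> = (\<integral>x. h x * indicator (box p q) x \<partial>lebesgue_on \<Omega>)"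
        using \<Omega>m by (simp add: integral_restrict_space)
      also have "\<dots> = 0" using pq_sub box0[of p q] by auto
      finally show ?thesis .
    qed
    (* the Dynkin argument needs a Borel measurable representative *)
    obtain H' where H': "H' \<in> borel_measurable lborel" "AE x in lborel. H x = H' x"
      using completion_ex_borel_measurable_real[of H lborel] Hm by blast
    have AE': "AE x in lebesgue. H x = H' x" using H'(2) by (rule AE_completion)
    have [measurable]: "H' \<in> borel_measurable borel" "H' \<in> borel_measurable lebesgue" "H \<in> borel_measurable lebesgue"
      using H'(1) Hm by (auto intro: measurable_completion)
    have H'i: "integrable lborel H'"
    proof -
      have "integrable lebesgue H'" using integrable_cong_AE[OF _ _ AE'] Hm by simp
      thus ?thesis using H'(1) by (simp add: integrable_completion)
    qed
    have box': "(\<integral>x. indicator (box a b) x * H' x \<partial>lborel) = 0" for a b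
    proof -
      have ib: "(\<lambda>x. indicator (box a b) x :: real) \<in> borel_measurable lebesgue"
        by (intro measurable_completion) simp
      have "(\<integral>x. indicator (box a b) x * H' x \<partial>lborel) = (\<integral>x. indicator (box a b) x * H' x \<partial>lebesgue)"
        by (intro integral_completion[symmetric]) measurable
      also have "\<dots> = (\<integral>x. indicator (box a b) x * H x \<partial>lebesgue)"
        using AE' ib by (intro integral_cong_AE) auto
      finally show ?thesis using Hbox by simp
    qed
    have total: "(\<integral>x. H' x \<partial>lborel) = 0"
    proof -
      have "(\<integral>x. H' x \<partial>lborel) = (\<integral>x. H' x \<partial>lebesgue)"
        by (intro integral_completion[symmetric]) measurable
      also have "\<dots> = (\<integral>x. H x \<partial>lebesgue)" using AE' by (intro integral_cong_AE) auto
      also have "\<dots> = (\<integral>x. indicator (box c d) x * H x \<partial>lebesgue)"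
        by (intro Bochner_Integration.integral_cong) (auto simp: H_def indicator_def)
      finally show ?thesis using Hbox by simp
    qed
    have "AE x in lebesgue. H' x = 0"
      using integrable_AE_zero_if_box_integrals_zero[OF H'i box' total] by (rule AE_completion)
    moreover have "AE x in lebesgue. x \<notin> cbox c d - box c d"
      using negligible_frontier_interval[of c d] unfolding negligible_iff_null_sets by (rule AE_not_in)
    ultimately show ?thesis using AE'
    proof eventually_elim
      case (elim x)
      thus ?case using sub box_subset_cbox[of c d] by (auto simp: H_def)
    qed
  qed
  obtain D where D: "countable D" "D \<subseteq> Pow \<Omega>" "\<And>X. X \<in> D \<Longrightarrow> \<exists>a b. X = cbox a b" "\<Union>D = \<Omega>"
    using open_countable_Union_open_cbox[OF \<Omega>] by metis
  have "AE x in lebesgue. \<forall>X\<in>D. x \<in> X \<longrightarrow> h x = 0"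
  proof (rule AE_ball_countable'[OF _ D(1)])
    fix X assume X: "X \<in> D"
    then obtain a b where "X = cbox a b" using D(3) by blast
    thus "AE x in lebesgue. x \<in> X \<longrightarrow> h x = 0" using local[of a b] X D(2) by blast
  qed
  hence "AE x in lebesgue. x \<in> \<Omega> \<longrightarrow> h x = 0"
    by eventually_elim (use D(4) in blast)
  thus ?thesis using \<Omega>m by (subst AE_restrict_space_iff) auto
qed

section \<open>The Sobolev space as a complete space of jets\<close>

lemma square_int_iff: "square_int \<Omega> h \<longleftrightarrow> sq_integrable (lebesgue_on \<Omega>) h"
  by (simp add: square_int_def sq_integrable_def)

lemma norm_fst_snd_le: "norm (fst z) \<le> norm z" "norm (snd z) \<le> norm z"
  by (cases z, simp add: norm_fst_le norm_snd_le)+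

text \<open>
  Lets bilinear expressions be treated as functionals of a pair of functions.
\<close>

lemma quadratic_modulus_product: "quadratic_modulus (\<lambda>z :: real \<times> real. fst z * snd z)"
proof (rule quadratic_modulusI[of _ 0 2 1])
  fix z w :: "real \<times> real"
  define n where "n = norm (z - w)"
  define m where "m = norm w"
  have n: "\<bar>fst (z - w)\<bar> \<le> n" "\<bar>snd (z - w)\<bar> \<le> n" and m: "\<bar>fst w\<bar> \<le> m" "\<bar>snd w\<bar> \<le> m"
    unfolding n_def m_def
    using norm_fst_snd_le[of "z - w"] norm_fst_snd_le[of w] by simp_all
  have "fst z * snd z - fst w * snd w
      = fst (z - w) * snd (z - w) + fst (z - w) * snd w + fst w * snd (z - w)"
    by (simp add: algebra_simps)
  hence "\<bar>fst z * snd z - fst w * snd w\<bar>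
      \<le> \<bar>fst (z - w) * snd (z - w)\<bar> + \<bar>fst (z - w) * snd w\<bar> + \<bar>fst w * snd (z - w)\<bar>" by linarith
  also have "\<dots> \<le> n * n + n * m + m * n"
    unfolding abs_mult using n m by (intro add_mono mult_mono) auto
  finally show "\<bar>fst z * snd z - fst w * snd w\<bar> \<le> (0 + 2 * norm w) * norm (z - w) + 1 * (norm (z - w))\<^sup>2"
    unfolding n_def m_def by (simp add: power2_eq_square algebra_simps)
qed

lemma sq_integrable_Pair:
  assumes "sq_integrable M h" "sq_integrable M k"
  shows "sq_integrable M (\<lambda>x. (h x, k x))"
proof -
  have [measurable]: "h \<in> borel_measurable M" "k \<in> borel_measurable M"
    using assms by (simp_all add: sq_integrable_def)
  have "(norm (h x, k x))\<^sup>2 = (norm (h x))\<^sup>2 + (norm (k x))\<^sup>2" for x by (simp add: norm_Pair)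
  thus ?thesis using assms by (simp add: sq_integrable_def)
qed

lemma sq_integrable_nth:
  fixes G :: "'a \<Rightarrow> real^'n"
  assumes "sq_integrable M G"
  shows "sq_integrable M (\<lambda>x. G x $ i)"
proof -
  have [measurable]: "G \<in> borel_measurable M" and i: "integrable M (\<lambda>x. (norm (G x))\<^sup>2)"
    using assms by (simp_all add: sq_integrable_def)
  have "(\<lambda>x. G x \<bullet> axis i 1) \<in> borel_measurable M" by simp
  hence m: "(\<lambda>x. G x $ i) \<in> borel_measurable M" by (simp add: inner_axis)
  have "\<bar>G x $ i\<bar>\<^sup>2 \<le> (norm (G x))\<^sup>2" for x
    using component_le_norm_cart[of "G x" i] by (intro power_mono) auto
  hence "integrable M (\<lambda>x. (G x $ i)\<^sup>2)"
    using m by (intro Bochner_Integration.integrable_bound[OF i]) auto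
  thus ?thesis using m by (simp add: sq_integrable_def)
qed

lemma L2_dist_cong_AE:
  assumes "sq_integrable M h" "sq_integrable M k" "sq_integrable M h'" "sq_integrable M k'"
    and "AE x in M. h x = h' x" "AE x in M. k x = k' x"
  shows "L2_dist M h k = L2_dist M h' k'"
proof -
  have [measurable]: "h \<in> borel_measurable M" "k \<in> borel_measurable M" "h' \<in> borel_measurable M" "k' \<in> borel_measurable M"
    using assms by (simp_all add: sq_integrable_def)
  show ?thesis unfolding L2_dist_def
    by (rule arg_cong[where f = sqrt], rule integral_cong_AE) (use assms(5,6) in \<open>auto elim: eventually_elim2\<close>)
qed

lemma L2_dist_eq_0_AE:
  assumes "sq_integrable M h" "sq_integrable M k" "L2_dist M h k = 0"
  shows "AE x in M. h x = k x"
proof -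
  have "integrable M (\<lambda>x. (norm (h x - k x))\<^sup>2)"
    using sq_integrable_diff[OF assms(1,2)] by (simp add: sq_integrable_def)
  moreover have "(\<integral>x. (norm (h x - k x))\<^sup>2 \<partial>M) = 0" using assms(3) by (simp add: L2_dist_def)
  ultimately have "AE x in M. (norm (h x - k x))\<^sup>2 = 0"
    by (subst (asm) integral_nonneg_eq_0_iff_AE) auto
  thus ?thesis by eventually_elim simp
qed

context finite_measure
begin

lemma integrable_mult_sq_integrable:
  fixes h k :: "'a \<Rightarrow> real"
  assumes "sq_integrable M h" "sq_integrable M k"
  shows "integrable M (\<lambda>x. h x * k x)"
  using integrable_quadratic_modulus[OF quadratic_modulus_product sq_integrable_Pair[OF assms]] by simp

lemma L2_convergence_integral_mult:
  fixes h :: "nat \<Rightarrow> 'a \<Rightarrow> real"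
  assumes "\<And>k. sq_integrable M (h k)" "sq_integrable M u" "sq_integrable M \<psi>"
    and lim: "(\<lambda>k. L2_dist M (h k) u) \<longlonglongrightarrow> 0"
  shows "(\<lambda>k. \<integral>x. h k x * \<psi> x \<partial>M) \<longlonglongrightarrow> (\<integral>x. u x * \<psi> x \<partial>M)"
proof -
  have "L2_dist M (\<lambda>x. (h k x, \<psi> x)) (\<lambda>x. (u x, \<psi> x)) = L2_dist M (h k) u" for k
    by (simp add: L2_dist_def norm_Pair)
  hence "(\<lambda>k. L2_dist M (\<lambda>x. (h k x, \<psi> x)) (\<lambda>x. (u x, \<psi> x))) \<longlonglongrightarrow> 0" using lim by simp
  from integral_functional_continuous[OF quadratic_modulus_product _ _ this]
  show ?thesis using assms by (simp add: sq_integrable_Pair)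
qed

end

locale bounded_open_domain =
  fixes \<Omega> :: "(real^'n) set"
  assumes open_dom: "open \<Omega>" and bounded_dom: "bounded \<Omega>"
begin

abbreviation M where "M \<equiv> lebesgue_on \<Omega>"

sublocale finite_measure M
  by (intro finite_measure_lebesgue_on lmeasurable_open open_dom bounded_dom)

text \<open>
  Continuous functions are bounded on the compact closure of \<open>\<Omega>\<close>. This suffices for test functions and
  their partial derivatives.
\<close>

lemma continuous_sq_integrable:
  fixes \<phi> :: "real^'n \<Rightarrow> real"
  assumes "continuous_on UNIV \<phi>"
  shows "sq_integrable M \<phi>"
proof -
  have "\<phi> \<in> borel_measurable borel" using assms by (rule borel_measurable_continuous_onI)
  hence [measurable]: "\<phi> \<in> borel_measurable M"
    by (intro measurable_restrict_space1 measurable_completion) simp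
  have "compact (\<phi> ` closure \<Omega>)"
    using assms bounded_dom by (intro compact_continuous_image) (auto intro: continuous_on_subset)
  then obtain B where B: "\<And>x. x \<in> \<Omega> \<Longrightarrow> norm (\<phi> x) \<le> B"
    using closure_subset[of \<Omega>] unfolding bounded_iff[of "\<phi> ` closure \<Omega>"]
    by (metis compact_imp_bounded bounded_iff imageI subsetD)
  have "integrable M (\<lambda>x. (norm (\<phi> x))\<^sup>2)"
  proof (rule integrable_const_bound)
    show "AE x in M. norm ((norm (\<phi> x))\<^sup>2) \<le> B\<^sup>2"
    proof (rule AE_I2)
      fix x assume "x \<in> space M"
      hence "(norm (\<phi> x))\<^sup>2 \<le> B\<^sup>2" using B by (intro power_mono) simp_all
      thus "norm ((norm (\<phi> x))\<^sup>2) \<le> B\<^sup>2" by simp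
    qed
  qed measurable
  thus ?thesis by (simp add: sq_integrable_def)
qed

lemma test_fun_sq_integrable:
  assumes "test_fun \<Omega> \<phi>"
  shows "sq_integrable M \<phi>" "sq_integrable M (\<lambda>x. grad \<phi> x $ i)"
proof -
  have "C_k 0 \<phi>" and 1: "C_k 1 \<phi>" using assms unfolding test_fun_def by blast+
  thus "sq_integrable M \<phi>" by (intro continuous_sq_integrable) simp
  have "continuous_on UNIV (\<lambda>x. grad \<phi> x \<bullet> axis i 1)" using 1 by (auto simp: axis_in_Basis_iff)
  thus "sq_integrable M (\<lambda>x. grad \<phi> x $ i)" by (intro continuous_sq_integrable) (simp add: inner_axis)
qed

lemma has_weak_grad_unique:
  assumes "has_weak_grad \<Omega> u G" "has_weak_grad \<Omega> u H"
  shows "AE x in M. G x = H x"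
proof -
  have GH: "sq_integrable M G" "sq_integrable M H" using assms by (auto simp: has_weak_grad_def square_int_iff)
  have "AE x in M. G x $ i - H x $ i = 0" for i
  proof (rule fundamental_lemma_calculus_of_variations[OF open_dom])
    show "integrable M (\<lambda>x. G x $ i - H x $ i)"
      by (intro sq_integrable_imp_integrable sq_integrable_diff sq_integrable_nth GH)
    fix \<phi> assume \<phi>: "test_fun \<Omega> \<phi>"
    have "integrable M (\<lambda>x. G x $ i * \<phi> x)" "integrable M (\<lambda>x. H x $ i * \<phi> x)"
      by (intro integrable_mult_sq_integrable sq_integrable_nth GH test_fun_sq_integrable(1)[OF \<phi>])+
    moreover have "(\<integral>x. u x * (grad \<phi> x $ i) \<partial>M) = - (\<integral>x. G x $ i * \<phi> x \<partial>M)"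
      "(\<integral>x. u x * (grad \<phi> x $ i) \<partial>M) = - (\<integral>x. H x $ i * \<phi> x \<partial>M)"
      using assms \<phi> unfolding has_weak_grad_def by blast+
    ultimately show "(\<integral>x. (G x $ i - H x $ i) * \<phi> x \<partial>M) = 0"
      by (simp add: left_diff_distrib)
  qed
  hence "AE x in M. \<forall>i. G x $ i - H x $ i = 0" by (simp add: AE_all_countable)
  thus ?thesis by eventually_elim (simp add: vec_eq_iff)
qed

lemma has_weak_grad_weak_grad:
  assumes "u \<in> H1 \<Omega>"
  shows "has_weak_grad \<Omega> u (weak_grad \<Omega> u)"
proof -
  have "\<exists>G. has_weak_grad \<Omega> u G" using assms by (simp add: H1_def)
  thus ?thesis unfolding weak_grad_def by (rule someI_ex)
qed

text \<open>
  The map from a Sobolev function to its jet carries the Sobolev norm to the norm of square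
  integrable functions with values in \<open>\<real> \<times> \<real>\<^sup>n\<close>.
\<close>

definition jet :: "(real^'n \<Rightarrow> real) \<Rightarrow> real^'n \<Rightarrow> real \<times> (real^'n)" where
  "jet u x = (u x, weak_grad \<Omega> u x)"

lemma H1I:
  assumes u: "sq_integrable M u" and G: "has_weak_grad \<Omega> u G"
  shows "u \<in> H1 \<Omega>" "AE x in M. jet u x = (u x, G x)"
proof -
  show "u \<in> H1 \<Omega>" using assms unfolding H1_def square_int_iff by blast
  from has_weak_grad_unique[OF has_weak_grad_weak_grad[OF this] G]
  show "AE x in M. jet u x = (u x, G x)" by eventually_elim (simp add: jet_def)
qed

lemma H1D:
  assumes "u \<in> H1 \<Omega>"
  shows "sq_integrable M u" "sq_integrable M (weak_grad \<Omega> u)" "sq_integrable M (jet u)"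
proof -
  show "sq_integrable M u" using assms by (simp add: H1_def square_int_iff)
  moreover show "sq_integrable M (weak_grad \<Omega> u)"
    using has_weak_grad_weak_grad[OF assms] by (simp add: has_weak_grad_def square_int_iff)
  ultimately show "sq_integrable M (jet u)" unfolding jet_def[abs_def] by (rule sq_integrable_Pair)
qed

lemma has_weak_grad_combination:
  assumes u: "sq_integrable M u" "has_weak_grad \<Omega> u G" and v: "sq_integrable M v" "has_weak_grad \<Omega> v H"
  shows "has_weak_grad \<Omega> (\<lambda>x. a * u x + b * v x) (\<lambda>x. a *\<^sub>R G x + b *\<^sub>R H x)"
  unfolding has_weak_grad_def square_int_iff
proof (intro conjI allI impI)
  have GH: "sq_integrable M G" "sq_integrable M H" using u v by (auto simp: has_weak_grad_def square_int_iff)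
  show "sq_integrable M (\<lambda>x. a *\<^sub>R G x + b *\<^sub>R H x)" by (intro sq_integrable_add sq_integrable_scale GH)
  fix \<phi> i assume \<phi>: "test_fun \<Omega> \<phi>"
  have 1: "integrable M (\<lambda>x. u x * (grad \<phi> x $ i))" "integrable M (\<lambda>x. v x * (grad \<phi> x $ i))"
    "integrable M (\<lambda>x. G x $ i * \<phi> x)" "integrable M (\<lambda>x. H x $ i * \<phi> x)"
    by (intro integrable_mult_sq_integrable sq_integrable_nth[OF GH(1)] sq_integrable_nth[OF GH(2)]
        u(1) v(1) test_fun_sq_integrable[OF \<phi>])+
  have 2: "(\<integral>x. u x * (grad \<phi> x $ i) \<partial>M) = - (\<integral>x. G x $ i * \<phi> x \<partial>M)"
    "(\<integral>x. v x * (grad \<phi> x $ i) \<partial>M) = - (\<integral>x. H x $ i * \<phi> x \<partial>M)"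
    using u v \<phi> unfolding has_weak_grad_def by blast+
  have "(\<integral>x. (a * u x + b * v x) * (grad \<phi> x $ i) \<partial>M)
      = (\<integral>x. a * (u x * (grad \<phi> x $ i)) + b * (v x * (grad \<phi> x $ i)) \<partial>M)"
    by (simp add: algebra_simps)
  also have "\<dots> = - (a * (\<integral>x. G x $ i * \<phi> x \<partial>M) + b * (\<integral>x. H x $ i * \<phi> x \<partial>M))"
    using 1 2 by simp
  also have "\<dots> = - (\<integral>x. a * (G x $ i * \<phi> x) + b * (H x $ i * \<phi> x) \<partial>M)" using 1 by simp
  also have "\<dots> = - (\<integral>x. (a *\<^sub>R G x + b *\<^sub>R H x) $ i * \<phi> x \<partial>M)" by (simp add: algebra_simps)
  finally show "(\<integral>x. (a * u x + b * v x) * (grad \<phi> x $ i) \<partial>M)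
      = - (\<integral>x. (a *\<^sub>R G x + b *\<^sub>R H x) $ i * \<phi> x \<partial>M)" .
qed

text \<open>
  The weak gradient is a choice, so it is linear only almost everywhere, by uniqueness.
\<close>

lemma H1_combination:
  assumes "u \<in> H1 \<Omega>" "v \<in> H1 \<Omega>"
  shows "(\<lambda>x. a * u x + b * v x) \<in> H1 \<Omega>"
    "AE x in M. jet (\<lambda>x. a * u x + b * v x) x = a *\<^sub>R jet u x + b *\<^sub>R jet v x"
proof -
  note uv = H1D(1)[OF assms(1)] H1D(1)[OF assms(2)]
  have "sq_integrable M (\<lambda>x. a * u x + b * v x)"
    using sq_integrable_add[OF sq_integrable_scale[OF uv(1), of a] sq_integrable_scale[OF uv(2), of b]] by simp
  note H = H1I[OF this has_weak_grad_combination[OF uv(1) has_weak_grad_weak_grad[OF assms(1)]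
        uv(2) has_weak_grad_weak_grad[OF assms(2)]]]
  show "(\<lambda>x. a * u x + b * v x) \<in> H1 \<Omega>" by (rule H(1))
  show "AE x in M. jet (\<lambda>x. a * u x + b * v x) x = a *\<^sub>R jet u x + b *\<^sub>R jet v x"
    using H(2) by eventually_elim (simp add: jet_def)
qed

lemma H1_norm_sq: "(H1_norm \<Omega> u)\<^sup>2 = (\<integral>x. (norm (jet u x))\<^sup>2 \<partial>M)"
proof -
  have "(\<integral>x. (norm (jet u x))\<^sup>2 \<partial>M) = (\<integral>x. (norm (weak_grad \<Omega> u x))\<^sup>2 + \<bar>u x\<bar>\<^sup>2 \<partial>M)"
    by (simp add: jet_def norm_Pair add.commute)
  moreover have "0 \<le> (\<integral>x. (norm (weak_grad \<Omega> u x))\<^sup>2 + \<bar>u x\<bar>\<^sup>2 \<partial>M)" by simp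
  ultimately show ?thesis unfolding H1_norm_def by (simp only: real_sqrt_pow2)
qed

lemma H1_norm_diff:
  assumes "u \<in> H1 \<Omega>" "v \<in> H1 \<Omega>"
  shows "H1_norm \<Omega> (\<lambda>x. u x - v x) = L2_dist M (jet u) (jet v)"
proof -
  have D: "(\<lambda>x. u x - v x) \<in> H1 \<Omega>" "AE x in M. jet (\<lambda>x. u x - v x) x = jet u x - jet v x"
    using H1_combination[OF assms, of 1 "-1"] by simp_all
  have [measurable]: "jet (\<lambda>x. u x - v x) \<in> borel_measurable M" "jet u \<in> borel_measurable M" "jet v \<in> borel_measurable M"
    using H1D(3)[OF D(1)] H1D(3)[OF assms(1)] H1D(3)[OF assms(2)] by (simp_all add: sq_integrable_def)
  have "(H1_norm \<Omega> (\<lambda>x. u x - v x))\<^sup>2 = (L2_dist M (jet u) (jet v))\<^sup>2"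
    unfolding H1_norm_sq L2_dist_sq
    by (rule integral_cong_AE) (use D(2) in \<open>auto elim: eventually_mono\<close>)
  moreover have "0 \<le> H1_norm \<Omega> (\<lambda>x. u x - v x)" unfolding H1_norm_def by simp
  ultimately show ?thesis
    using L2_dist_nonneg[of M "jet u" "jet v"] by (simp only: power2_eq_iff_nonneg)
qed

text \<open>
  The limit of the jets is the jet of its first component: both sides of the defining identity of
  the weak gradient pass to the limit against a fixed test function.
\<close>

lemma H1_complete:
  assumes s: "\<And>k. s k \<in> H1 \<Omega>"
    and cauchy: "\<And>e. 0 < e \<Longrightarrow> \<exists>N. \<forall>m\<ge>N. \<forall>n\<ge>m. L2_dist M (jet (s m)) (jet (s n)) < e"
  shows "\<exists>u\<in>H1 \<Omega>. (\<lambda>k. L2_dist M (jet (s k)) (jet u)) \<longlonglongrightarrow> 0"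
proof -
  have J: "sq_integrable M (jet (s k))" for k by (rule H1D(3)[OF s])
  obtain U where U: "sq_integrable M U" "(\<lambda>k. L2_dist M (jet (s k)) U) \<longlonglongrightarrow> 0"
    using L2_complete[OF finite_measure_axioms J cauchy] by blast
  define u where "u x = fst (U x)" for x
  define G where "G x = snd (U x)" for x
  have Um[measurable]: "U \<in> borel_measurable M" and Ui: "integrable M (\<lambda>x. (norm (U x))\<^sup>2)"
    using U(1) by (simp_all add: sq_integrable_def)
  have [measurable]: "u \<in> borel_measurable M" "G \<in> borel_measurable M"
    unfolding u_def[abs_def] G_def[abs_def]
    by (intro measurable_compose[OF Um] borel_measurable_continuous_onI continuous_intros)+
  have le: "(norm (u x))\<^sup>2 \<le> (norm (U x))\<^sup>2" "(norm (G x))\<^sup>2 \<le> (norm (U x))\<^sup>2" for x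
    unfolding u_def G_def by (intro power_mono norm_fst_snd_le norm_ge_zero)+
  have u: "sq_integrable M u" and G: "sq_integrable M G"
    unfolding sq_integrable_def
    using le by (auto intro!: Bochner_Integration.integrable_bound[OF Ui])
  have dist: "L2_dist M p v \<le> L2_dist M (jet (s k)) U"
    if "\<And>x. norm (p x - v x) \<le> norm (jet (s k) x - U x)" "sq_integrable M p" "sq_integrable M v"
    for k and p v :: "real^'n \<Rightarrow> real"
    unfolding L2_dist_def
    using sq_integrable_diff[OF that(2,3)] sq_integrable_diff[OF J U(1)] that(1)
    by (intro real_sqrt_le_mono integral_mono power_mono) (auto simp: sq_integrable_def)
  have lim: "(\<lambda>k. L2_dist M (h k) v) \<longlonglongrightarrow> 0"
    if "\<And>k x. norm (h k x - v x) \<le> norm (jet (s k) x - U x)" "\<And>k. sq_integrable M (h k)" "sq_integrable M v"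
    for h :: "nat \<Rightarrow> real^'n \<Rightarrow> real" and v
  proof (rule tendsto_sandwich[OF _ _ tendsto_const U(2)])
    show "\<forall>\<^sub>F k in sequentially. 0 \<le> L2_dist M (h k) v" by (simp add: L2_dist_nonneg)
    show "\<forall>\<^sub>F k in sequentially. L2_dist M (h k) v \<le> L2_dist M (jet (s k)) U"
      by (intro always_eventually allI dist that)
  qed
  have fst_le: "norm (s k x - u x) \<le> norm (jet (s k) x - U x)" for k x
    using norm_fst_snd_le(1)[of "jet (s k) x - U x"] by (simp add: jet_def u_def)
  have snd_le: "norm (weak_grad \<Omega> (s k) x $ i - G x $ i) \<le> norm (jet (s k) x - U x)" for k x i
    using norm_fst_snd_le(2)[of "jet (s k) x - U x"] component_le_norm_cart[of "weak_grad \<Omega> (s k) x - G x" i]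
    by (simp add: jet_def G_def)
  have lim_u: "(\<lambda>k. L2_dist M (s k) u) \<longlonglongrightarrow> 0"
    by (rule lim[where h = s, OF fst_le H1D(1)[OF s] u])
  have lim_G: "(\<lambda>k. L2_dist M (\<lambda>x. weak_grad \<Omega> (s k) x $ i) (\<lambda>x. G x $ i)) \<longlonglongrightarrow> 0" for i
    by (rule lim[where h = "\<lambda>k x. weak_grad \<Omega> (s k) x $ i",
          OF snd_le sq_integrable_nth[OF H1D(2)[OF s]] sq_integrable_nth[OF G]])
  have weak: "(\<integral>x. u x * (grad \<phi> x $ i) \<partial>M) = - (\<integral>x. G x $ i * \<phi> x \<partial>M)" if \<phi>: "test_fun \<Omega> \<phi>" for \<phi> i
  proof (rule LIMSEQ_unique)
    show "(\<lambda>k. \<integral>x. s k x * (grad \<phi> x $ i) \<partial>M) \<longlonglongrightarrow> (\<integral>x. u x * (grad \<phi> x $ i) \<partial>M)"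
      by (rule L2_convergence_integral_mult[where h = s, OF H1D(1)[OF s] u test_fun_sq_integrable(2)[OF \<phi>] lim_u])
    have "(\<lambda>k. \<integral>x. weak_grad \<Omega> (s k) x $ i * \<phi> x \<partial>M) \<longlonglongrightarrow> (\<integral>x. G x $ i * \<phi> x \<partial>M)"
      by (rule L2_convergence_integral_mult[where h = "\<lambda>k x. weak_grad \<Omega> (s k) x $ i",
            OF sq_integrable_nth[OF H1D(2)[OF s]] sq_integrable_nth[OF G] test_fun_sq_integrable(1)[OF \<phi>] lim_G])
    hence "(\<lambda>k. - (\<integral>x. weak_grad \<Omega> (s k) x $ i * \<phi> x \<partial>M)) \<longlonglongrightarrow> - (\<integral>x. G x $ i * \<phi> x \<partial>M)"
      by (rule tendsto_minus)
    moreover have "(\<integral>x. s k x * (grad \<phi> x $ i) \<partial>M) = - (\<integral>x. weak_grad \<Omega> (s k) x $ i * \<phi> x \<partial>M)" for k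
      using has_weak_grad_weak_grad[OF s, of k] \<phi> unfolding has_weak_grad_def by blast
    ultimately show "(\<lambda>k. \<integral>x. s k x * (grad \<phi> x $ i) \<partial>M) \<longlonglongrightarrow> - (\<integral>x. G x $ i * \<phi> x \<partial>M)"
      by (simp only:)
  qed
  have "has_weak_grad \<Omega> u G"
    unfolding has_weak_grad_def square_int_iff using G weak by blast
  note uH = H1I[OF u this]
  have "AE x in M. U x = jet u x" using uH(2) by eventually_elim (simp add: u_def G_def)
  hence "L2_dist M (jet (s k)) U = L2_dist M (jet (s k)) (jet u)" for k
    by (intro L2_dist_cong_AE J U(1) H1D(3)[OF uH(1)]) auto
  with U(2) uH(1) show ?thesis by auto
qed

end

section \<open>The constrained problem\<close>

context bounded_open_domain
begin

lemma int_functional_jet: "int_functional \<Omega> F u = (\<integral>x. F (jet u x) \<partial>M)"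
  by (simp add: int_functional_def jet_def)

text \<open>
  Transfers a pointwise midpoint inequality for the integrand to the functional.
\<close>

lemma int_functional_midpoint:
  assumes F: "quadratic_modulus F" and u: "u \<in> H1 \<Omega>" and v: "v \<in> H1 \<Omega>"
    and conv: "\<And>z w. 2 * F ((1 / 2) *\<^sub>R (z + w)) + c * (norm (z - w))\<^sup>2 \<le> F z + F w"
  shows "2 * int_functional \<Omega> F (\<lambda>x. 1 / 2 * (u x + v x)) + c * (L2_dist M (jet u) (jet v))\<^sup>2
     \<le> int_functional \<Omega> F u + int_functional \<Omega> F v"
proof -
  define m where "m = (\<lambda>x. 1 / 2 * u x + 1 / 2 * v x)"
  have m: "m \<in> H1 \<Omega>" "AE x in M. jet m x = (1 / 2) *\<^sub>R jet u x + (1 / 2) *\<^sub>R jet v x"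
    unfolding m_def by (rule H1_combination[OF u v])+
  note sq = H1D(3)[OF u] H1D(3)[OF v]
  have "integrable M (\<lambda>x. F (jet m x))" by (rule integrable_quadratic_modulus[OF F H1D(3)[OF m(1)]])
  moreover have "integrable M (\<lambda>x. F ((1 / 2) *\<^sub>R (jet u x + jet v x)))"
    by (intro integrable_quadratic_modulus F sq_integrable_scale sq_integrable_add sq)
  ultimately have "int_functional \<Omega> F m = (\<integral>x. F ((1 / 2) *\<^sub>R (jet u x + jet v x)) \<partial>M)"
    unfolding int_functional_jet using m(2)
    by (intro integral_cong_AE) (auto elim!: eventually_mono simp: scaleR_add_right)
  moreover have "m = (\<lambda>x. 1 / 2 * (u x + v x))" by (simp add: m_def fun_eq_iff field_simps)
  ultimately show ?thesis
    using integral_functional_midpoint[OF F sq conv] by (simp add: int_functional_jet)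
qed

lemma int_functional_scale:
  assumes F: "quadratic_modulus F" and u: "u \<in> H1 \<Omega>"
  shows "int_functional \<Omega> F (\<lambda>x. t * u x) = (\<integral>x. F (t *\<^sub>R jet u x) \<partial>M)"
proof -
  have m: "(\<lambda>x. t * u x) \<in> H1 \<Omega>" "AE x in M. jet (\<lambda>x. t * u x) x = t *\<^sub>R jet u x"
    using H1_combination[OF u u, of t 0] by simp_all
  have "integrable M (\<lambda>x. F (jet (\<lambda>x. t * u x) x))"
    by (rule integrable_quadratic_modulus[OF F H1D(3)[OF m(1)]])
  moreover have "integrable M (\<lambda>x. F (t *\<^sub>R jet u x))"
    by (intro integrable_quadratic_modulus F sq_integrable_scale H1D(3) u)
  ultimately show ?thesis unfolding int_functional_jet using m(2)
    by (intro integral_cong_AE) (auto elim!: eventually_mono)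
qed

lemma int_functional_combination:
  assumes "quadratic_modulus F" "quadratic_modulus G" "u \<in> H1 \<Omega>"
  shows "int_functional \<Omega> (\<lambda>z. a * F z + b * G z) u = a * int_functional \<Omega> F u + b * int_functional \<Omega> G u"
  unfolding int_functional_jet
  using integrable_quadratic_modulus[OF assms(1) H1D(3)[OF assms(3)]]
    integrable_quadratic_modulus[OF assms(2) H1D(3)[OF assms(3)]] by simp

end

text \<open>
  The hypotheses common to the minimum and the maximum problem; the latter is the instance with
  \<open>- f\<close> in place of \<open>f\<close>.
\<close>

locale constrained_problem = bounded_open_domain \<Omega> for \<Omega> :: "(real^'n) set" +
  fixes f g :: "real \<times> (real^'n) \<Rightarrow> real" and V :: "(real^'n \<Rightarrow> real) set" and L \<nu> :: real
  assumes f_diff: "\<And>z. f differentiable (at z)" and f_lip: "L-lipschitz_on UNIV (grad f)" and L_pos: "0 < L"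
    and g_diff: "\<And>z. g differentiable (at z)" and g_lip: "\<nu>-lipschitz_on UNIV (grad g)" and \<nu>: "\<nu> < 2"
    and g_nonneg: "\<And>z. 0 \<le> g z" and g_0: "g 0 = 0"
    and V: "closed_subspace_H1 \<Omega> V"
begin

text \<open>
  The largest multiplier for which the pointwise estimates keep \<open>N + a J\<close> convex.
\<close>

definition a where "a = (2 - \<nu>) / L"

abbreviation J where "J \<equiv> int_functional \<Omega> f"

definition N where "N u = (H1_norm \<Omega> u)\<^sup>2 + int_functional \<Omega> g u"

text \<open>
  The integrand of \<open>N\<close> as a function of the jet.
\<close>

definition h where "h z = (norm z)\<^sup>2 + g z"

lemma a_pos: "0 < a" using L_pos \<nu> by (simp add: a_def)

lemma a_L: "a * L = 2 - \<nu>" using L_pos by (simp add: a_def)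

lemma V_subset: "V \<subseteq> H1 \<Omega>"
  using V unfolding closed_subspace_H1_def by (elim conjE)

lemma V_H1: "u \<in> V \<Longrightarrow> u \<in> H1 \<Omega>"
  using V_subset by (rule subsetD)

lemma V_zero: "(\<lambda>x. 0) \<in> V"
  using V unfolding closed_subspace_H1_def by (elim conjE)

lemma V_add: "\<forall>u\<in>V. \<forall>v\<in>V. (\<lambda>x. u x + v x) \<in> V"
  using V unfolding closed_subspace_H1_def by (elim conjE)

lemma V_mult: "\<forall>c. \<forall>u\<in>V. (\<lambda>x. c * u x) \<in> V"
  using V unfolding closed_subspace_H1_def by (elim conjE)

lemma V_closed: "\<forall>s. \<forall>u\<in>H1 \<Omega>. (\<forall>k. s k \<in> V) \<and>
     (\<lambda>k. H1_norm \<Omega> (\<lambda>x. s k x - u x)) \<longlonglongrightarrow> 0 \<longrightarrow> u \<in> V"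
  using V unfolding closed_subspace_H1_def by (elim conjE)

lemma V_scale: "u \<in> V \<Longrightarrow> (\<lambda>x. c * u x) \<in> V"
  by (rule V_mult[rule_format])

lemma V_mid: "u \<in> V \<Longrightarrow> v \<in> V \<Longrightarrow> (\<lambda>x. 1 / 2 * (u x + v x)) \<in> V"
  by (rule V_scale[OF V_add[rule_format]])

lemma qm_f: "quadratic_modulus f" by (rule quadratic_modulus_lipschitz_grad[OF f_diff f_lip])

lemma qm_g: "quadratic_modulus g" by (rule quadratic_modulus_lipschitz_grad[OF g_diff g_lip])

lemma qm_h: "quadratic_modulus h"
  using quadratic_modulus_combination[OF quadratic_modulus_norm_sq qm_g, of 1 1] by (simp add: h_def[abs_def])

lemma qm_hf: "quadratic_modulus (\<lambda>z. h z + l * f z)"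
  using quadratic_modulus_combination[OF qm_h qm_f, of 1 l] by simp

lemma N_eq: "u \<in> V \<Longrightarrow> N u = int_functional \<Omega> h u"
  using int_functional_combination[OF quadratic_modulus_norm_sq qm_g V_H1, of u 1 1]
  by (simp add: N_def h_def[abs_def] H1_norm_sq int_functional_jet)

lemma NJ_eq: "u \<in> V \<Longrightarrow> N u + l * J u = int_functional \<Omega> (\<lambda>z. h z + l * f z) u"
  using int_functional_combination[OF qm_h qm_f V_H1, of u 1 l] by (simp add: N_eq)

text \<open>
  The variational argument uses convexity only at midpoints and completeness only for a
  pseudo-distance, so it is stated without linear structure. Elements at distance \<open>0\<close> are not
  identified, which lets functions stand for their classes modulo null sets.
\<close>

sublocale complete_midpoint_space V "\<lambda>u v x. 1 / 2 * (u x + v x)" "\<lambda>u v. L2_dist M (jet u) (jet v)"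
proof
  show "V \<noteq> {}" using V_zero by blast
  show "L2_dist M (jet u) (jet u) = 0" for u by (simp add: L2_dist_def)
  fix s :: "nat \<Rightarrow> real^'n \<Rightarrow> real"
  assume s: "\<And>k. s k \<in> V"
    and cauchy: "\<And>e. 0 < e \<Longrightarrow> \<exists>N. \<forall>m\<ge>N. \<forall>n\<ge>m. L2_dist M (jet (s m)) (jet (s n)) < e"
  obtain u where u: "u \<in> H1 \<Omega>" "(\<lambda>k. L2_dist M (jet (s k)) (jet u)) \<longlonglongrightarrow> 0"
    using H1_complete[OF V_H1[OF s] cauchy] by blast
  hence "(\<lambda>k. H1_norm \<Omega> (\<lambda>x. s k x - u x)) \<longlonglongrightarrow> 0"
    using V_H1[OF s] by (simp add: H1_norm_diff)
  with s have "u \<in> V" by (intro V_closed[rule_format, OF u(1)] conjI allI)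
  with u(2) show "\<exists>u\<in>V. (\<lambda>k. L2_dist M (jet (s k)) (jet u)) \<longlonglongrightarrow> 0" by blast
next
  show "(\<lambda>x. 1 / 2 * (u x + v x)) \<in> V" if "u \<in> V" "v \<in> V" for u v by (rule V_mid[OF that])
qed (rule L2_dist_nonneg L2_dist_commute)+

lemma seq_continuous_int_functional:
  assumes F: "quadratic_modulus F"
  shows "seq_continuous (int_functional \<Omega> F)"
  unfolding seq_continuous_def int_functional_jet
  using integral_functional_continuous[OF F H1D(3)[OF V_H1] H1D(3)[OF V_H1]] by blast

lemma N_continuous: "seq_continuous N"
  using seq_continuous_int_functional[OF qm_h] unfolding seq_continuous_def by (auto simp: N_eq)

lemma J_continuous: "seq_continuous J"
  by (rule seq_continuous_int_functional[OF qm_f])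

lemma norm_sq_midpoint: "2 * (norm ((1 / 2) *\<^sub>R (z + w)))\<^sup>2 + 1 / 2 * (norm (z - w))\<^sup>2
    = (norm z)\<^sup>2 + (norm w)\<^sup>2" for z w :: "'z::real_inner"
proof -
  have "(norm ((1 / 2) *\<^sub>R (z + w)))\<^sup>2 = 1 / 4 * (norm (z + w))\<^sup>2" by (simp add: power_divide)
  moreover have "(norm (z + w))\<^sup>2 + (norm (z - w))\<^sup>2 = 2 * (norm z)\<^sup>2 + 2 * (norm w)\<^sup>2"
    by (simp add: power2_norm_eq_inner inner_add_left inner_add_right inner_diff_left inner_diff_right)
  ultimately show ?thesis by linarith
qed

text \<open>
  The parallelogram identity contributes \<open>1/2\<close> and \<open>g\<close> costs \<open>\<nu>/4\<close>.
\<close>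

lemma h_midpoint: "2 * h ((1 / 2) *\<^sub>R (z + w)) + (2 - \<nu>) / 4 * (norm (z - w))\<^sup>2 \<le> h z + h w"
proof -
  define m where "m = (1 / 2) *\<^sub>R (z + w)"
  have "2 * g m \<le> g z + g w + \<nu> / 4 * (norm (z - w))\<^sup>2"
    unfolding m_def by (rule lipschitz_grad_midpoint[OF g_diff g_lip])
  moreover have "2 * (norm m)\<^sup>2 + 1 / 2 * (norm (z - w))\<^sup>2 = (norm z)\<^sup>2 + (norm w)\<^sup>2"
    unfolding m_def by (rule norm_sq_midpoint)
  moreover have "(2 - \<nu>) / 4 * (norm (z - w))\<^sup>2
      = 1 / 2 * (norm (z - w))\<^sup>2 - \<nu> / 4 * (norm (z - w))\<^sup>2" by (simp add: field_simps)
  ultimately show ?thesis unfolding h_def m_def[symmetric] by (simp only: distrib_left)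
qed

text \<open>
  Since \<open>a L = 2 - \<nu>\<close>, the defect of \<open>a f\<close> uses up exactly the strong convexity of \<open>h\<close>.
\<close>

lemma hf_midpoint: "2 * (h ((1 / 2) *\<^sub>R (z + w)) + a * f ((1 / 2) *\<^sub>R (z + w))) + 0 * (norm (z - w))\<^sup>2
    \<le> (h z + a * f z) + (h w + a * f w)"
proof -
  define q where "q = (norm (z - w))\<^sup>2"
  have "2 * f ((1 / 2) *\<^sub>R (z + w)) \<le> f z + f w + L / 4 * q"
    unfolding q_def by (rule lipschitz_grad_midpoint[OF f_diff f_lip])
  hence "a * (2 * f ((1 / 2) *\<^sub>R (z + w))) \<le> a * (f z + f w + L / 4 * q)"
    using a_pos by (intro mult_left_mono) auto
  also have "\<dots> = a * f z + a * f w + (2 - \<nu>) / 4 * q"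
    unfolding a_L[symmetric] by (simp add: algebra_simps)
  finally show ?thesis using h_midpoint[of z w] unfolding q_def[symmetric] by simp
qed

lemma N_convex: "midpoint_convex ((2 - \<nu>) / 4) N"
  unfolding midpoint_convex_def
proof (intro ballI)
  fix u v assume uv: "u \<in> V" "v \<in> V"
  show "2 * N (\<lambda>x. 1 / 2 * (u x + v x)) + (2 - \<nu>) / 4 * (L2_dist M (jet u) (jet v))\<^sup>2 \<le> N u + N v"
    unfolding N_eq[OF uv(1)] N_eq[OF uv(2)] N_eq[OF V_mid[OF uv]]
    by (rule int_functional_midpoint[OF qm_h V_H1[OF uv(1)] V_H1[OF uv(2)] h_midpoint])
qed

lemma NJ_convex: "midpoint_convex 0 (\<lambda>u. N u + a * J u)"
  unfolding midpoint_convex_def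
proof (intro ballI)
  fix u v assume uv: "u \<in> V" "v \<in> V"
  show "2 * (N (\<lambda>x. 1 / 2 * (u x + v x)) + a * J (\<lambda>x. 1 / 2 * (u x + v x)))
      + 0 * (L2_dist M (jet u) (jet v))\<^sup>2 \<le> N u + a * J u + (N v + a * J v)"
    unfolding NJ_eq[OF uv(1)] NJ_eq[OF uv(2)] NJ_eq[OF V_mid[OF uv]]
    by (rule int_functional_midpoint[OF qm_hf V_H1[OF uv(1)] V_H1[OF uv(2)] hf_midpoint])
qed

text \<open>
  For \<open>l < a\<close> the coefficient \<open>1 - l L / 2\<close> of the squared norm in the pointwise lower bound is positive
  and absorbs the linear term.
\<close>

lemma NJ_bounded_below:
  assumes l: "0 \<le> l" "l < a"
  shows "\<exists>B. \<forall>u\<in>V. B \<le> N u + l * J u"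
proof -
  define e where "e = 2 - l * L"
  have "l * L < a * L" using l L_pos by simp
  hence e: "0 < e" using lipschitz_on_nonneg[OF g_lip] unfolding e_def a_L by linarith
  define G where "G = l * norm (grad f 0)"
  define B where "B = - (\<bar>l * f 0\<bar> + G\<^sup>2 / e)"
  have pt: "B \<le> h z + l * f z" for z
  proof -
    define q where "q = (norm z)\<^sup>2"
    have "f 0 + grad f 0 \<bullet> z - L / 2 * q \<le> f z"
      using lipschitz_grad_lower[OF f_diff f_lip, of 0 z] unfolding q_def by simp
    moreover have "- (norm (grad f 0) * norm z) \<le> grad f 0 \<bullet> z"
      using Cauchy_Schwarz_ineq2[of "grad f 0" z] by (simp add: abs_le_iff)
    ultimately have "f 0 - norm (grad f 0) * norm z - L / 2 * q \<le> f z" by linarith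
    hence "l * (f 0 - norm (grad f 0) * norm z - L / 2 * q) \<le> l * f z" using l by (intro mult_left_mono)
    hence 1: "l * f 0 - G * norm z - (l * L) / 2 * q \<le> l * f z"
      by (simp add: G_def algebra_simps)
    have 2: "2 * (norm z * G) \<le> e * q + G\<^sup>2 / e"
      unfolding q_def by (rule mult_le_weighted_squares[OF e])
    have "0 \<le> G\<^sup>2 / e" using e by simp
    moreover have "e * q = 2 * q - l * L * q" by (simp add: e_def algebra_simps)
    ultimately show ?thesis
      using 1 2 g_nonneg[of z] abs_ge_self[of "- (l * f 0)"]
      unfolding B_def h_def q_def[symmetric] by (simp add: mult.commute[of _ G] field_simps)
  qed
  have "B * measure M (space M) \<le> N u + l * J u" if "u \<in> V" for u
  proof -
    have "(\<integral>x. B \<partial>M) \<le> (\<integral>x. h (jet u x) + l * f (jet u x) \<partial>M)"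
      by (intro integral_mono pt integrable_quadratic_modulus[OF qm_hf] H1D(3) V_H1 that) simp
    thus ?thesis unfolding NJ_eq[OF that] unfolding int_functional_jet by (simp add: mult.commute)
  qed
  thus ?thesis by blast
qed

lemma N_zero: "N (\<lambda>x. 0) = 0"
proof -
  have "N (\<lambda>x. 0 * 0) = (\<integral>x. h (0 *\<^sub>R jet (\<lambda>x. 0) x) \<partial>M)"
    using int_functional_scale[OF qm_h V_H1[OF V_zero], of 0] V_zero by (simp add: N_eq)
  thus ?thesis by (simp add: h_def g_0)
qed

theorem unique_minimum_on_level_set:
  assumes r: "0 < r" and above: "\<And>u. minimises (\<lambda>v. N v + a * J v) u \<Longrightarrow> r < N u"
  shows "ex1_ae \<Omega> (is_arg_min J (\<lambda>u. u \<in> V \<and> N u = r))"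
proof -
  have c: "0 < (2 - \<nu>) / 4" using \<nu> by simp
  have "\<exists>u\<in>V. N u = r \<and> (\<forall>v\<in>V. N v = r \<longrightarrow> J u \<le> J v \<and> (J v = J u \<longrightarrow> L2_dist M (jet u) (jet v) = 0))"
  proof (rule level_set_minimiser[OF a_pos c N_convex N_continuous NJ_convex J_continuous _ V_zero])
    show "N (\<lambda>x. 0) < r" using r N_zero by simp
  qed (use NJ_bounded_below above in blast)+
  then obtain u where u: "u \<in> V" "N u = r" "\<And>v. v \<in> V \<Longrightarrow> N v = r \<Longrightarrow> J u \<le> J v"
    "\<And>v. v \<in> V \<Longrightarrow> N v = r \<Longrightarrow> J v = J u \<Longrightarrow> L2_dist M (jet u) (jet v) = 0" by blast
  show ?thesis unfolding ex1_ae_def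
  proof (intro exI[of _ u] conjI allI impI)
    show "is_arg_min J (\<lambda>u. u \<in> V \<and> N u = r) u"
      using u(1-3) unfolding is_arg_min_def by (auto simp: not_less)
    fix v assume "is_arg_min J (\<lambda>u. u \<in> V \<and> N u = r) v"
    hence v: "v \<in> V" "N v = r" "J v \<le> J u" using u(1,2) unfolding is_arg_min_def by (auto simp: not_less)
    have "L2_dist M (jet u) (jet v) = 0" using antisym[OF v(3) u(3)[OF v(1,2)]] by (rule u(4)[OF v(1,2)])
    hence "AE x in M. jet u x = jet v x"
      by (rule L2_dist_eq_0_AE[OF H1D(3)[OF V_H1[OF u(1)]] H1D(3)[OF V_H1[OF v(1)]]])
    thus "AE x in M. v x = u x" by eventually_elim (simp add: jet_def)
  qed
qed

text \<open>
  Along the line through \<open>v\<close> the functional exceeds its value at \<open>0\<close> by at most \<open>(a D) t + 2 Q t\<^sup>2\<close>, where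
  \<open>D\<close> is the derivative of \<open>J\<close> in the direction \<open>v\<close> and \<open>Q\<close> the squared norm of \<open>v\<close>, because the gradient of \<open>g\<close> vanishes at its minimum \<open>0\<close>. This parabola is therefore nonnegative, so its slope
  at \<open>0\<close> is zero.
\<close>

lemma zero_minimiser_imp_critical:
  assumes min: "minimises (\<lambda>v. N v + a * J v) (\<lambda>x. 0)" and v: "v \<in> V"
  shows "(\<integral>x. grad f 0 \<bullet> jet v x \<partial>M) = 0"
proof -
  have g_grad: "grad g 0 = 0"
  proof -
    have "((\<lambda>h. h \<bullet> grad g 0)) = (\<lambda>h. 0)"
      using differentiable_GDERIV_grad[OF g_diff, of 0] g_nonneg g_0 unfolding GDERIV_iff
      by (intro differential_zero_maxmin[of 0 UNIV g]) auto
    from fun_cong[OF this, of "grad g 0"] show ?thesis by simp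
  qed
  define D where "D = (\<integral>x. grad f 0 \<bullet> jet v x \<partial>M)"
  define Q where "Q = (\<integral>x. (norm (jet v x))\<^sup>2 \<partial>M)"
  note J = H1D(3)[OF V_H1[OF v]]
  have Di: "integrable M (\<lambda>x. grad f 0 \<bullet> jet v x)" using sq_integrable_imp_integrable[OF J] by simp
  have Qi: "integrable M (\<lambda>x. (norm (jet v x))\<^sup>2)" using J by (simp add: sq_integrable_def)
  have est: "h (t *\<^sub>R z) + a * f (t *\<^sub>R z) \<le> (h 0 + a * f 0) + (a * t) * (grad f 0 \<bullet> z) + 2 * t\<^sup>2 * (norm z)\<^sup>2" for t z
  proof -
    define q where "q = (norm (t *\<^sub>R z))\<^sup>2"
    have g: "g (t *\<^sub>R z) \<le> \<nu> / 2 * q"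
      using lipschitz_grad_upper[OF g_diff g_lip, of "t *\<^sub>R z" 0] unfolding q_def by (simp add: g_grad g_0)
    have "f (t *\<^sub>R z) \<le> f 0 + t * (grad f 0 \<bullet> z) + L / 2 * q"
      using lipschitz_grad_upper[OF f_diff f_lip, of "t *\<^sub>R z" 0] unfolding q_def by simp
    hence "a * f (t *\<^sub>R z) \<le> a * (f 0 + t * (grad f 0 \<bullet> z) + L / 2 * q)"
      using a_pos by (intro mult_left_mono) auto
    also have "\<dots> = a * f 0 + (a * t) * (grad f 0 \<bullet> z) + (a * L) / 2 * q" by (simp add: algebra_simps)
    finally have f: "a * f (t *\<^sub>R z) \<le> a * f 0 + (a * t) * (grad f 0 \<bullet> z) + (2 - \<nu>) / 2 * q" unfolding a_L .
    have "(2 - \<nu>) / 2 * q + \<nu> / 2 * q + q = 2 * q" by (simp add: field_simps)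
    moreover have "q = t\<^sup>2 * (norm z)\<^sup>2" by (simp add: q_def power_mult_distrib)
    ultimately show ?thesis using f g unfolding h_def q_def[symmetric] by (simp add: g_0)
  qed
  have ineq: "0 \<le> (a * D) * t + (2 * Q) * t\<^sup>2" for t
  proof -
    have "N (\<lambda>x. 0) + a * J (\<lambda>x. 0) \<le> N (\<lambda>x. t * v x) + a * J (\<lambda>x. t * v x)"
      using min V_scale[OF v] unfolding minimises_def by blast
    moreover have "N (\<lambda>x. t * v x) + a * J (\<lambda>x. t * v x) = (\<integral>x. h (t *\<^sub>R jet v x) + a * f (t *\<^sub>R jet v x) \<partial>M)"
      for t unfolding NJ_eq[OF V_scale[OF v]] by (rule int_functional_scale[OF qm_hf V_H1[OF v]])
    note * = this[of t] this[of 0]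
    ultimately have "(\<integral>x. h 0 + a * f 0 \<partial>M) \<le> (\<integral>x. h (t *\<^sub>R jet v x) + a * f (t *\<^sub>R jet v x) \<partial>M)"
      using * by simp
    also have "\<dots> \<le> (\<integral>x. (h 0 + a * f 0) + (a * t) * (grad f 0 \<bullet> jet v x) + 2 * t\<^sup>2 * (norm (jet v x))\<^sup>2 \<partial>M)"
      using Di Qi by (intro integral_mono est integrable_quadratic_modulus[OF qm_hf] sq_integrable_scale J) auto
    also have "\<dots> = (\<integral>x. h 0 + a * f 0 \<partial>M) + (a * t) * D + 2 * t\<^sup>2 * Q"
      using Di Qi by (simp add: D_def Q_def)
    finally show ?thesis by (simp add: algebra_simps)
  qed
  have "((\<lambda>t. (a * D) * t + (2 * Q) * t\<^sup>2) has_real_derivative (a * D)) (at 0)"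
    by (auto intro!: derivative_eq_intros)
  hence "a * D = 0"
    by (rule DERIV_local_min[where d = 1]) (simp_all add: ineq)
  thus ?thesis using a_pos by (simp add: D_def)
qed

text \<open>
  If \<open>N\<close> came arbitrarily close to \<open>0\<close> on the minimisers, these would tend to \<open>0\<close> in the Sobolev norm and
  \<open>0\<close> would be a minimiser by continuity, hence a critical point.
\<close>

lemma inf_minimisers_pos:
  assumes v0: "v \<in> V" "(\<integral>x. grad f 0 \<bullet> jet v x \<partial>M) \<noteq> 0"
  shows "0 < (INF u\<in>{u. minimises (\<lambda>v. N v + a * J v) u}. ereal (N u))"
proof (rule ccontr)
  let ?S = "{u. minimises (\<lambda>v. N v + a * J v) u}"
  assume "\<not> 0 < (INF u\<in>?S. ereal (N u))"
  hence neg: "(INF u\<in>?S. ereal (N u)) \<le> 0" by (simp only: not_less)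
  have ex: "\<exists>u. minimises (\<lambda>v. N v + a * J v) u \<and> N u < 1 / real (Suc k)" for k
  proof -
    have "(INF u\<in>?S. ereal (N u)) < ereal (1 / real (Suc k))"
      using neg by (rule order.strict_trans1) simp
    then obtain u where "u \<in> ?S" "ereal (N u) < ereal (1 / real (Suc k))"
      unfolding INF_less_iff by blast
    thus ?thesis by auto
  qed
  define s where "s k = (SOME u. minimises (\<lambda>v. N v + a * J v) u \<and> N u < 1 / real (Suc k))" for k :: nat
  have s: "minimises (\<lambda>v. N v + a * J v) (s k)" "N (s k) < 1 / real (Suc k)" for k
    using someI_ex[OF ex[of k]] unfolding s_def by auto
  have sV: "s k \<in> V" for k using s(1) unfolding minimises_def by blast
  have "(L2_dist M (jet (s k)) (jet (\<lambda>x. 0)))\<^sup>2 \<le> inverse (real (Suc k))" for k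
  proof -
    have "(L2_dist M (jet (s k)) (jet (\<lambda>x. 0)))\<^sup>2 = (H1_norm \<Omega> (s k))\<^sup>2"
      using H1_norm_diff[OF V_H1[OF sV] V_H1[OF V_zero]] by simp
    also have "\<dots> \<le> N (s k)" unfolding N_def int_functional_def by (simp add: g_nonneg)
    finally show ?thesis using s(2)[of k] by (simp add: inverse_eq_divide)
  qed
  hence "(\<lambda>k. (L2_dist M (jet (s k)) (jet (\<lambda>x. 0)))\<^sup>2) \<longlonglongrightarrow> 0"
    by (intro tendsto_sandwich[OF _ _ tendsto_const LIMSEQ_inverse_real_of_nat]) auto
  hence "(\<lambda>k. sqrt ((L2_dist M (jet (s k)) (jet (\<lambda>x. 0)))\<^sup>2)) \<longlonglongrightarrow> sqrt 0" by (rule tendsto_real_sqrt)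
  hence lim: "(\<lambda>k. L2_dist M (jet (s k)) (jet (\<lambda>x. 0))) \<longlonglongrightarrow> 0" by (simp add: L2_dist_nonneg)
  have cont: "seq_continuous (\<lambda>v. N v + a * J v)"
    using seq_continuous_combination[OF N_continuous J_continuous, of 1 a] by simp
  have lim_NJ: "(\<lambda>k. N (s k) + a * J (s k)) \<longlonglongrightarrow> N (\<lambda>x. 0) + a * J (\<lambda>x. 0)"
    by (rule seq_continuousD[OF cont sV V_zero lim])
  have "minimises (\<lambda>v. N v + a * J v) (\<lambda>x. 0)"
    unfolding minimises_def
  proof (intro conjI V_zero ballI)
    fix w assume w: "w \<in> V"
    have le: "N (s k) + a * J (s k) \<le> N w + a * J w" for k
      using s(1)[of k] w unfolding minimises_def by blast
    show "N (\<lambda>x. 0) + a * J (\<lambda>x. 0) \<le> N w + a * J w"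
      by (rule LIMSEQ_le_const2[OF lim_NJ]) (intro exI[of _ 0] allI impI le)
  qed
  from zero_minimiser_imp_critical[OF this v0(1)] v0(2) show False by simp
qed

end

section \<open>Existence and uniqueness of constrained extrema\<close>

theorem theorem2:
  fixes \<Omega> :: "(real^'n) set"
    and f g :: "real \<times> (real^'n) \<Rightarrow> real"
    and V :: "(real^'n \<Rightarrow> real) set"
    and L \<nu> :: real
  defines "J \<equiv> int_functional \<Omega> f"
    and "I \<equiv> int_functional \<Omega> g"
  defines "S \<equiv> {u. is_arg_min (\<lambda>u. (H1_norm \<Omega> u)\<^sup>2 + I u + (2 - \<nu>) / L * J u) (\<lambda>u. u \<in> V) u}"
    and "S1 \<equiv> {u. is_arg_min (\<lambda>u. (H1_norm \<Omega> u)\<^sup>2 + I u - (2 - \<nu>) / L * J u) (\<lambda>u. u \<in> V) u}"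
  defines "\<delta>1 \<equiv> min (INF u\<in>S. ereal ((H1_norm \<Omega> u)\<^sup>2 + I u))
                    (INF u\<in>S1. ereal ((H1_norm \<Omega> u)\<^sup>2 + I u))"
  assumes "open \<Omega>" and "connected \<Omega>" and "\<Omega> \<noteq> {}" and "bounded \<Omega>"
    and "C_k 1 f" and "\<not> grad f constant_on UNIV" and "\<exists>C. C-lipschitz_on UNIV (grad f)"
    and "L = lipschitz_const (grad f)"
    and "C_k 1 g" and "\<And>z. 0 \<le> g z" and "g 0 = 0"
    and "\<nu>-lipschitz_on UNIV (grad g)" and "\<nu> < 2"
    and "closed_subspace_H1 \<Omega> V"
    and "\<exists>v\<^sub>0\<in>V. (\<integral>x. partial_xi f 0 * v\<^sub>0 x + grad_eta f 0 \<bullet> weak_grad \<Omega> v\<^sub>0 x \<partial>lebesgue_on \<Omega>) \<noteq> 0"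
  shows "\<delta>1 > 0 \<and>
    (\<forall>r::real. 0 < r \<and> ereal r < \<delta>1 \<longrightarrow>
       ex1_ae \<Omega> (is_arg_min J (\<lambda>u. u \<in> V \<and> (H1_norm \<Omega> u)\<^sup>2 + I u = r)) \<and>
       ex1_ae \<Omega> (is_arg_max J (\<lambda>u. u \<in> V \<and> (H1_norm \<Omega> u)\<^sup>2 + I u = r)))"
proof -
  have f1: "f differentiable (at z)" and g1: "g differentiable (at z)" for z
    using \<open>C_k 1 f\<close> \<open>C_k 1 g\<close> unfolding One_nat_def C_k.simps by blast+
  have f_lip: "L-lipschitz_on UNIV (grad f)"
    unfolding \<open>L = lipschitz_const (grad f)\<close> by (rule lipschitz_const_attained) fact
  have L_pos: "0 < L"
    unfolding \<open>L = lipschitz_const (grad f)\<close> by (rule lipschitz_const_pos) fact+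
  have grad_neg: "grad (\<lambda>z. - f z) = (\<lambda>z. - grad f z)" using grad_uminus[OF f1] by blast
  have neg_lip: "L-lipschitz_on UNIV (grad (\<lambda>z. - f z))"
    unfolding grad_neg using f_lip by (simp add: lipschitz_on_def dist_minus)
  have neg1: "(\<lambda>z. - f z) differentiable (at z)" for z using f1 by (rule differentiable_minus)
  interpret P: constrained_problem \<Omega> f g V L \<nu>
    by unfold_locales (fact f1 g1 f_lip L_pos assms)+
  (* both instances have the same \<open>N\<close>, \<open>a\<close>, jets and space; only the integrand changes sign *)
  interpret Q: constrained_problem \<Omega> "\<lambda>z. - f z" g V L \<nu>
    by unfold_locales (fact neg1 g1 neg_lip L_pos assms)+
  have N: "P.N = (\<lambda>u. (H1_norm \<Omega> u)\<^sup>2 + I u)"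
    unfolding P.N_def[abs_def] I_def by (rule refl)
  have a: "P.a = (2 - \<nu>) / L" unfolding P.a_def by (rule refl)
  have J_neg: "int_functional \<Omega> (\<lambda>z. - f z) u = - J u" for u
    unfolding J_def int_functional_def by simp
  have S: "S = {u. P.minimises (\<lambda>v. P.N v + P.a * J v) u}"
    unfolding S_def N a P.minimises_def is_arg_min_def by (auto simp: not_less)
  have S1: "S1 = {u. P.minimises (\<lambda>v. P.N v + P.a * int_functional \<Omega> (\<lambda>z. - f z) v) u}"
    unfolding S1_def N a P.minimises_def is_arg_min_def J_neg by (auto simp: not_less)
  obtain v0 where v0: "v0 \<in> V"
    "(\<integral>x. partial_xi f 0 * v0 x + grad_eta f 0 \<bullet> weak_grad \<Omega> v0 x \<partial>lebesgue_on \<Omega>) \<noteq> 0"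
    using assms by blast
  have v0_P: "(\<integral>x. grad f 0 \<bullet> P.jet v0 x \<partial>lebesgue_on \<Omega>) \<noteq> 0"
    using v0(2) by (simp add: grad_pair_component[OF f1] P.jet_def inner_prod_def)
  hence v0_Q: "(\<integral>x. grad (\<lambda>z. - f z) 0 \<bullet> P.jet v0 x \<partial>lebesgue_on \<Omega>) \<noteq> 0"
    by (simp add: grad_neg)
  have "0 < (INF u\<in>S. ereal (P.N u))" "0 < (INF u\<in>S1. ereal (P.N u))"
    unfolding S S1 J_def using P.inf_minimisers_pos[OF v0(1) v0_P] Q.inf_minimisers_pos[OF v0(1) v0_Q] by blast+
  hence pos: "0 < \<delta>1" unfolding \<delta>1_def N by simp
  have "ex1_ae \<Omega> (is_arg_min J (\<lambda>u. u \<in> V \<and> P.N u = r)) \<and>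
      ex1_ae \<Omega> (is_arg_max J (\<lambda>u. u \<in> V \<and> P.N u = r))" if r: "0 < r" "ereal r < \<delta>1" for r
  proof
    have rS: "r < P.N u" if "u \<in> S" for u
    proof -
      have "\<delta>1 \<le> ereal (P.N u)" unfolding \<delta>1_def N by (rule min.coboundedI1[OF INF_lower[OF that]])
      from less_le_trans[OF r(2) this] show ?thesis by simp
    qed
    have rS1: "r < P.N u" if "u \<in> S1" for u
    proof -
      have "\<delta>1 \<le> ereal (P.N u)" unfolding \<delta>1_def N by (rule min.coboundedI2[OF INF_lower[OF that]])
      from less_le_trans[OF r(2) this] show ?thesis by simp
    qed
    show "ex1_ae \<Omega> (is_arg_min J (\<lambda>u. u \<in> V \<and> P.N u = r))"
      unfolding J_def by (rule P.unique_minimum_on_level_set[OF r(1) rS]) (simp only: S J_def mem_Collect_eq)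
    have "ex1_ae \<Omega> (is_arg_min (int_functional \<Omega> (\<lambda>z. - f z)) (\<lambda>u. u \<in> V \<and> P.N u = r))"
      by (rule Q.unique_minimum_on_level_set[OF r(1) rS1]) (simp only: S1 mem_Collect_eq)
    moreover have "is_arg_min (int_functional \<Omega> (\<lambda>z. - f z)) (\<lambda>u. u \<in> V \<and> P.N u = r)
        = is_arg_max J (\<lambda>u. u \<in> V \<and> P.N u = r)"
      by (intro ext) (simp only: is_arg_min_def is_arg_max_def J_neg neg_less_iff_less)
    ultimately show "ex1_ae \<Omega> (is_arg_max J (\<lambda>u. u \<in> V \<and> P.N u = r))" by (simp only:)
  qed
  hence "\<forall>r::real. 0 < r \<and> ereal r < \<delta>1 \<longrightarrow>
      ex1_ae \<Omega> (is_arg_min J (\<lambda>u. u \<in> V \<and> P.N u = r)) \<and>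
      ex1_ae \<Omega> (is_arg_max J (\<lambda>u. u \<in> V \<and> P.N u = r))" by blast
  with pos show ?thesis unfolding N by (rule conjI)
qed

end
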